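(* Let $r=0$ and let $(\mathrm x,\mathrm y,I)$ be non-degenerate data. Then the permuton energy $\mathfrak E(h)$, $h\in\mathfrak F^{\mathrm x,\mathrm y,I}$, has a unique maximizer, and it has the following form in terms of its density $g=-h_{xy}$: (i) on each rectangle $(\mathrm x_{u-1},\mathrm x_u)\times(\mathrm y_{v-1},\mathrm y_v)$, $1\le u\le k$, $1\le v\le\ell$, the density is constant, $$g(x,y)=\frac{g^{uv}}{(\mathrm x_u-\mathrm x_{u-1})(\mathrm y_v-\mathrm y_{v-1})},\qquad x\in(\mathrm x_{u-1},\mathrm x_u),\ y\in(\mathrm y_{v-1},\mathrm y_v);$$ (ii) there exist two sequences of positive reals $\lambda_1,\dots,\lambda_k$ and $\mu_1,\dots,\mu_\ell$ such that $g^{uv}=I_{uv}\lambda_u\mu_v$; these sequences are found from the $k+\ell$ conditions $$\mathrm x_u-\mathrm x_{u-1}=\sum_{v=1}^\ell I_{uv}\lambda_u\mu_v,\quad u=1,\dots,k,\qquad \mathrm y_v-\mathrm y_{v-1}=\sum_{u=1}^kI_{uv}\lambda_u\mu_v,\quad v=1,\dots,\ell.$$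
   Context: Data: positive integers $k,\ell$, reals $0=\mathrm x_0<\mathrm x_1<\dots<\mathrm x_k=1$ and $0=\mathrm y_0<\mathrm y_1<\dots<\mathrm y_\ell=1$, and a $0/1$ array $I=[I_{uv}]_{1\le u\le k,1\le v\le\ell}$ (not assumed convex). The data are non-degenerate if there is a non-negative real array $[B_{uv}]$ with $B_{uv}>0$ if and only if $I_{uv}=1$, $\sum_v B_{uv}=\mathrm x_u-\mathrm x_{u-1}$ for all $u$, and $\sum_u B_{uv}=\mathrm y_v-\mathrm y_{v-1}$ for all $v$. $\mathfrak F$ is the class of real functions $h(x,y)$, $0\le x,y\le1$, which are $1$-Lipschitz in each variable, satisfy $h(x_1,y_1)+h(x_2,y_2)-h(x_1,y_2)-h(x_2,y_1)\le0$ for all $0\le x_1<x_2\le1$, $0\le y_1<y_2\le1$, and satisfy $h(x,0)=0$, $h(x,1)=1-x$, $h(0,y)=y$, $h(1,y)=0$. Such $h$ correspond bijectively to probability measures $\mu$ on $[0,1]^2$ with uniform marginals via $h(x,y)=\mu([x,1]\times[0,y])$. $\mathfrak F^{\mathrm x,\mathrm y,I}$ is the set of $h\in\mathfrak F$ with $h(\mathrm x_u,\mathrm y_v)+h(\mathrm x_{u-1},\mathrm y_{v-1})-h(\mathrm x_u,\mathrm y_{v-1})-h(\mathrm x_{u-1},\mathrm y_v)=0$ whenever $I_{uv}=0$. For $r=0$ the permuton energy is $\mathfrak E(h)=\int_0^1\int_0^1h_{xy}\ln(-h_{xy})\,dx\,dy$, meaning $-\int\int\mu(x,y)\ln\mu(x,y)\,dx\,dy$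 if $\mu$ has a Lebesgue density $\mu(x,y)=-h_{xy}$ (with $0\ln0=0$); $\mathfrak E(h)=-\infty$ if $\mu$ is not absolutely continuous or the integral equals $-\infty$. *)

theory Defs
  imports "HOL-Probability.Probability"
begin

definition mesh :: "nat \<Rightarrow> (nat \<Rightarrow> real) \<Rightarrow> bool" where
  "mesh n t \<longleftrightarrow> 1 \<le> n \<and> t 0 = 0 \<and> t n = 1 \<and> strict_mono_on {0..n} t"

definition nondegenerate ::
    "nat \<Rightarrow> nat \<Rightarrow> (nat \<Rightarrow> real) \<Rightarrow> (nat \<Rightarrow> real) \<Rightarrow> (nat \<Rightarrow> nat \<Rightarrow> nat) \<Rightarrow> bool" where
  "nondegenerate k l x y I \<longleftrightarrow>
     (\<exists>B :: nat \<Rightarrow> nat \<Rightarrow> real.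
        (\<forall>u\<in>{1..k}. \<forall>v\<in>{1..l}. 0 \<le> B u v \<and> (0 < B u v \<longleftrightarrow> I u v = 1)) \<and>
        (\<forall>u\<in>{1..k}. (\<Sum>v=1..l. B u v) = x u - x (u - 1)) \<and>
        (\<forall>v\<in>{1..l}. (\<Sum>u=1..k. B u v) = y v - y (v - 1)))"

definition unit_square :: "(real \<times> real) set" where
  "unit_square = {0..1} \<times> {0..1}"

text \<open>
  A function on the unit square is an element of \<^term>\<open>extensional unit_square\<close>, so that
  equality of functions in the class is equality on the square.
\<close>

definition height_functions :: "(real \<times> real \<Rightarrow> real) set" where
  "height_functions = {h \<in> extensional unit_square.
     (\<forall>t\<in>{0..1}. 1-lipschitz_on {0..1} (\<lambda>s. h (s, t))) \<and>
     (\<forall>s\<in>{0..1}. 1-lipschitz_on {0..1} (\<lambda>t. h (s, t))) \<and>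
     (\<forall>s1 s2 t1 t2. 0 \<le> s1 \<and> s1 < s2 \<and> s2 \<le> 1 \<and> 0 \<le> t1 \<and> t1 < t2 \<and> t2 \<le> 1 \<longrightarrow>
        h (s1, t1) + h (s2, t2) - h (s1, t2) - h (s2, t1) \<le> 0) \<and>
     (\<forall>s\<in>{0..1}. h (s, 0) = 0 \<and> h (s, 1) = 1 - s) \<and>
     (\<forall>t\<in>{0..1}. h (0, t) = t \<and> h (1, t) = 0)}"

definition height_functions_on ::
    "nat \<Rightarrow> nat \<Rightarrow> (nat \<Rightarrow> real) \<Rightarrow> (nat \<Rightarrow> real) \<Rightarrow> (nat \<Rightarrow> nat \<Rightarrow> nat) \<Rightarrow> (real \<times> real \<Rightarrow> real) set" where
  "height_functions_on k l x y I = {h \<in> height_functions.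
     \<forall>u\<in>{1..k}. \<forall>v\<in>{1..l}. I u v = 0 \<longrightarrow>
       h (x u, y v) + h (x (u - 1), y (v - 1)) - h (x u, y (v - 1)) - h (x (u - 1), y v) = 0}"

definition permuton :: "(real \<times> real) measure \<Rightarrow> bool" where
  "permuton M \<longleftrightarrow> prob_space M \<and> sets M = sets (restrict_space borel unit_square) \<and>
     distr M borel fst = uniform_measure lborel {0..1} \<and>
     distr M borel snd = uniform_measure lborel {0..1}"

definition permuton_of :: "(real \<times> real \<Rightarrow> real) \<Rightarrow> (real \<times> real) measure \<Rightarrow> bool" where
  "permuton_of h M \<longleftrightarrow> permuton M \<and>
     (\<forall>s\<in>{0..1}. \<forall>t\<in>{0..1}. h (s, t) = measure M ({s..1} \<times> {0..t}))"

definition permuton_density :: "(real \<times> real \<Rightarrow> real) \<Rightarrow> (real \<times> real \<Rightarrow> real) \<Rightarrow> bool" where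
  "permuton_density h g \<longleftrightarrow>
     g \<in> borel_measurable (restrict_space borel unit_square) \<and>
     (\<forall>z\<in>unit_square. 0 \<le> g z) \<and>
     permuton_of h (density (restrict_space lborel unit_square) (\<lambda>z. ennreal (g z)))"

text \<open>
  Densities are unique up to null sets, so the choice of \<open>g\<close> is immaterial. By Radon--Nikodym
  there is no density exactly if the permuton is not absolutely continuous. Since
  \<open>- g ln g \<le> 1 / e\<close> on a set of finite measure, its integral always exists in
  \<open>[-\<infinity>, \<infinity>)\<close>, and it is \<open>-\<infinity>\<close> exactly if the integrand is not integrable.
  The convention \<open>0 ln 0 = 0\<close> holds as \<open>0 * a = 0\<close>.
\<close>

definition permuton_energy :: "(real \<times> real \<Rightarrow> real) \<Rightarrow> ereal" where
  "permuton_energy h =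
     (if \<exists>g. permuton_density h g then
        let g = (SOME g. permuton_density h g) in
          if integrable (restrict_space lborel unit_square) (\<lambda>z. g z * ln (g z))
          then ereal (- (LINT z|restrict_space lborel unit_square. g z * ln (g z)))
          else -\<infinity>
      else -\<infinity>)"

definition margin_equations ::
    "nat \<Rightarrow> nat \<Rightarrow> (nat \<Rightarrow> real) \<Rightarrow> (nat \<Rightarrow> real) \<Rightarrow> (nat \<Rightarrow> nat \<Rightarrow> nat) \<Rightarrow>
     (nat \<Rightarrow> real) \<Rightarrow> (nat \<Rightarrow> real) \<Rightarrow> bool" where
  "margin_equations k l x y I lam mu \<longleftrightarrow>
     (\<forall>u\<in>{1..k}. x u - x (u - 1) = (\<Sum>v=1..l. real (I u v) * lam u * mu v)) \<and>
     (\<forall>v\<in>{1..l}. y v - y (v - 1) = (\<Sum>u=1..k. real (I u v) * lam u * mu v))"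

end

theory Submission
  imports Defs "HOL-Real_Asymp.Real_Asymp"
begin

text \<open>
  The maximizer is found by guessing its form and is then verified by Gibbs' inequality.

  Let \<open>q\<close> be the density of a permuton in the class such that \<open>q (s, t) = exp (\<phi> s + \<psi> t)\<close> wherever
  \<open>q\<close> does not vanish and such that \<open>q\<close> vanishes only on the forbidden cells. Every density \<open>g\<close> in
  the class vanishes on these cells almost everywhere, so that \<open>\<integral> g ln q = \<integral> g (\<phi> + \<psi>)\<close>, and this
  number depends only on the margins of \<open>g\<close>. As all permutons have uniform margins, it is a constant
  \<open>C\<close>, and it equals \<open>\<integral> q ln q\<close>. Integrating the pointwise inequality \<open>g ln g - g ln q - g + q \<ge> 0\<close>
  gives \<open>- \<integral> g ln g \<le> - C\<close>, and equality forces \<open>g = q\<close> almost everywhere, hence equality of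
  the height functions (\<open>product_form_unique_maximizer\<close>).

  It remains to produce such a \<open>q\<close> that is constant on the cells of the mesh. This is
  the problem of scaling a nonnegative matrix to given row and column sums: among all nonnegative
  matrices with the prescribed support and margins, one of maximal entropy exists by compactness.
  Its entries on the support are positive, because the entropy has infinite slope at a vanishing entry
  in the direction of the matrix that non-degeneracy provides. At a positive maximizer
  the logarithm is orthogonal to all perturbations with zero margins, and is therefore a sum of a
  function of the row and a function of the column (\<open>matrix_scaling\<close>).
  That the scaled matrix does not depend on the solution of the margin equations follows from
  Gibbs' inequality for matrices (\<open>scaled_matrix_unique\<close>).
\<close>

section \<open>Scaling a matrix to prescribed margins\<close>

text \<open>
  The inequality \<open>ln r \<le> r - 1\<close>, strict unless \<open>r = 1\<close>, at \<open>r = b / a\<close>. It is used for the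
  entries of matrices and for the values of densities alike.
\<close>
lemma gibbs_pointwise:
  fixes a b :: real
  assumes "0 \<le> a" "0 < b"
  shows "0 \<le> a * ln a - a * ln b - a + b"
    and "a * ln a - a * ln b - a + b = 0 \<Longrightarrow> a = b"
proof -
  have *: "0 \<le> a * ln a - a * ln b - a + b \<and> (a * ln a - a * ln b - a + b = 0 \<longrightarrow> a = b)"
  proof (cases "a = 0")
    case False
    with assms have a: "a > 0" by simp
    define r where "r = b / a"
    have r: "r > 0" using a assms r_def by simp
    have "a * ln a - a * ln b - a + b = a * (r - 1 - ln r)"
      using a assms by (simp add: r_def ln_div field_simps)
    moreover have "ln r \<le> r - 1" using ln_le_minus_one[OF r] .
    moreover have "r = 1" if "r - 1 - ln r = 0" using ln_eq_minus_one[OF r] that by simp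
    ultimately show ?thesis using a by (auto simp: r_def)
  qed (use assms in auto)
  show "0 \<le> a * ln a - a * ln b - a + b" and "a * ln a - a * ln b - a + b = 0 \<Longrightarrow> a = b"
    using * by auto
qed

lemma continuous_on_times_ln: "continuous_on {0..} (\<lambda>t::real. t * ln t)"
  unfolding continuous_on_eq_continuous_within
proof
  fix t :: real assume "t \<in> {0..}"
  show "continuous (at t within {0..}) (\<lambda>t. t * ln t)"
  proof (cases "t = 0")
    case True
    have "((\<lambda>t::real. t * ln t) \<longlongrightarrow> 0) (at_right 0)" by real_asymp
    then have "((\<lambda>t::real. t * ln t) \<longlongrightarrow> 0) (at 0 within {0..})"
      by (simp add: at_within_Ici_at_right)
    with True show ?thesis by (simp add: continuous_within)
  next
    case False
    then show ?thesis by (intro continuous_intros) auto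
  qed
qed

text \<open>
  Gibbs' inequality says that the graph of \<open>t ln t\<close> lies above its tangent at \<open>c\<close>. With \<open>c\<close> the
  mixture of \<open>a\<close> and \<open>b\<close>, the weighted average of the two tangent inequalities at \<open>a\<close> and \<open>b\<close> is
  convexity.
\<close>
lemma convex_times_ln_mix:
  fixes a b e :: real
  assumes "0 \<le> a" "0 < b" "0 < e" "e < 1"
  shows "((1 - e) * a + e * b) * ln ((1 - e) * a + e * b) \<le> (1 - e) * (a * ln a) + e * (b * ln b)"
proof -
  define c where "c = (1 - e) * a + e * b"
  have c: "c > 0" using assms by (simp add: c_def add_nonneg_pos)
  have "0 \<le> (1 - e) * (a * ln a - a * ln c - a + c) + e * (b * ln b - b * ln c - b + c)"
    using gibbs_pointwise(1)[OF assms(1) c] gibbs_pointwise(1)[OF less_imp_le[OF assms(2)] c] assms by simp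
  also have "\<dots> = (1 - e) * (a * ln a) + e * (b * ln b) - c * ln c + (c - ((1 - e) * a + e * b))"
    by (simp add: c_def algebra_simps)
  finally show ?thesis by (simp add: c_def)
qed

text \<open>
  Induction over the functionals. If \<open>f j\<close> is nonzero at some \<open>d0\<close> in the common kernel of the
  others, then subtracting from \<open>w\<close> the multiple of \<open>f j\<close> that kills \<open>w\<close> at \<open>d0\<close> leaves a
  functional that vanishes on the whole kernel of the others, since that kernel is spanned
  by \<open>d0\<close> and the kernel with \<open>f j\<close> included.
\<close>
lemma in_span_if_vanishes_on_kernel:
  fixes f :: "'i \<Rightarrow> 'e \<Rightarrow> real" and w :: "'e \<Rightarrow> real"
  assumes "finite A" "finite E"
    and "\<And>d. (\<forall>i\<in>A. (\<Sum>e\<in>E. f i e * d e) = 0) \<Longrightarrow> (\<Sum>e\<in>E. w e * d e) = 0"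
  shows "\<exists>c. \<forall>e\<in>E. w e = (\<Sum>i\<in>A. c i * f i e)"
  using assms(1,3)
proof (induction A arbitrary: w rule: finite_induct)
  case empty
  have "w e = 0" if "e \<in> E" for e
  proof -
    have "(\<Sum>e'\<in>E. w e' * (if e' = e then 1 else 0)) = 0" by (rule empty) simp
    moreover have "(\<Sum>e'\<in>E. w e' * (if e' = e then 1 else 0)) = w e"
      using assms(2) that by (simp add: if_distrib cong: if_cong)
    ultimately show ?thesis by simp
  qed
  then show ?case by simp
next
  case (insert j A)
  show ?case
  proof (cases "\<exists>d. (\<forall>i\<in>A. (\<Sum>e\<in>E. f i e * d e) = 0) \<and> (\<Sum>e\<in>E. f j e * d e) \<noteq> 0")
    case False
    then have "\<And>d. (\<forall>i\<in>A. (\<Sum>e\<in>E. f i e * d e) = 0) \<Longrightarrow> (\<Sum>e\<in>E. w e * d e) = 0"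
      using insert.prems by auto
    from insert.IH[OF this] obtain c where c: "\<forall>e\<in>E. w e = (\<Sum>i\<in>A. c i * f i e)" by blast
    show ?thesis
    proof (intro exI ballI)
      fix e assume "e \<in> E"
      then show "w e = (\<Sum>i\<in>insert j A. (c(j := 0)) i * f i e)"
        using c insert.hyps by (auto intro!: sum.cong)
    qed
  next
    case True
    then obtain d0 where d0: "\<forall>i\<in>A. (\<Sum>e\<in>E. f i e * d0 e) = 0" and n0: "(\<Sum>e\<in>E. f j e * d0 e) \<noteq> 0"
      by blast
    define a where "a = (\<Sum>e\<in>E. w e * d0 e) / (\<Sum>e\<in>E. f j e * d0 e)"
    have "(\<Sum>e\<in>E. (w e - a * f j e) * d e) = 0" if d: "\<forall>i\<in>A. (\<Sum>e\<in>E. f i e * d e) = 0" for d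
    proof -
      \<comment> \<open>The vector \<open>d - r d0\<close> lies in the kernel of \<open>f j\<close> as well.\<close>
      define r where "r = (\<Sum>e\<in>E. f j e * d e) / (\<Sum>e\<in>E. f j e * d0 e)"
      have eq: "(\<Sum>e\<in>E. g e * (d e - r * d0 e)) = (\<Sum>e\<in>E. g e * d e) - r * (\<Sum>e\<in>E. g e * d0 e)" for g
        by (simp add: algebra_simps sum_subtractf sum_distrib_left)
      have "r * (\<Sum>e\<in>E. f j e * d0 e) = (\<Sum>e\<in>E. f j e * d e)" using n0 by (simp add: r_def)
      then have "(\<Sum>e\<in>E. w e * (d e - r * d0 e)) = 0"
        by (intro insert.prems) (use d d0 in \<open>auto simp: eq\<close>)
      then have "(\<Sum>e\<in>E. w e * d e) = r * (\<Sum>e\<in>E. w e * d0 e)" by (simp add: eq)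
      also have "\<dots> = a * (\<Sum>e\<in>E. f j e * d e)" by (simp add: a_def r_def)
      finally show ?thesis by (simp add: algebra_simps sum_subtractf sum_distrib_left)
    qed
    from insert.IH[OF this] obtain c where c: "\<forall>e\<in>E. w e - a * f j e = (\<Sum>i\<in>A. c i * f i e)" by blast
    show ?thesis
    proof (intro exI ballI)
      fix e assume e: "e \<in> E"
      have *: "(\<Sum>i\<in>insert j A. (c(j := a)) i * f i e) = a * f j e + (\<Sum>i\<in>A. c i * f i e)"
        using insert.hyps by (auto intro!: sum.cong)
      then show "w e = (\<Sum>i\<in>insert j A. (c(j := a)) i * f i e)" using * bspec[OF c e] by linarith
    qed
  qed
qed

text \<open>
  Margins are summed over the fibres of the support \<open>E\<close> only, so that a matrix with this
  support may be represented by any function that agrees with it on \<open>E\<close>.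
\<close>
definition same_margins :: "('u \<times> 'v) set \<Rightarrow> ('u \<times> 'v \<Rightarrow> real) \<Rightarrow> ('u \<times> 'v \<Rightarrow> real) \<Rightarrow> bool" where
  "same_margins E G B \<longleftrightarrow>
     (\<forall>u. (\<Sum>e\<in>{e\<in>E. fst e = u}. G e) = (\<Sum>e\<in>{e\<in>E. fst e = u}. B e)) \<and>
     (\<forall>v. (\<Sum>e\<in>{e\<in>E. snd e = v}. G e) = (\<Sum>e\<in>{e\<in>E. snd e = v}. B e))"

lemma same_margins_cong:
  assumes "\<And>e. e \<in> E \<Longrightarrow> G e = G' e" "\<And>e. e \<in> E \<Longrightarrow> B e = B' e"
  shows "same_margins E G B \<longleftrightarrow> same_margins E G' B'"
proof -
  have "sum G X = sum G' X" "sum B X = sum B' X" if "X \<subseteq> E" for X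
    using assms that by (auto intro!: sum.cong)
  then show ?thesis by (simp add: same_margins_def)
qed

text \<open>
  Zero margins mean that all row sums and all column sums vanish, and \<open>w\<close> is a combination of these
  functionals. Rows and columns index them through a disjoint sum.
\<close>
lemma additive_if_orthogonal_to_zero_margins:
  fixes w :: "'u \<times> 'v \<Rightarrow> real"
  assumes E: "finite E"
    and orth: "\<And>d. same_margins E d (\<lambda>_. 0) \<Longrightarrow> (\<Sum>e\<in>E. w e * d e) = 0"
  shows "\<exists>\<alpha> \<beta>. \<forall>(u, v)\<in>E. w (u, v) = \<alpha> u + \<beta> v"
proof -
  define f :: "'u + 'v \<Rightarrow> 'u \<times> 'v \<Rightarrow> real"
    where "f = case_sum (\<lambda>u e. of_bool (fst e = u)) (\<lambda>v e. of_bool (snd e = v))"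
  define A where "A = fst ` E <+> snd ` E"
  have "\<exists>c. \<forall>e\<in>E. w e = (\<Sum>i\<in>A. c i * f i e)"
  proof (rule in_span_if_vanishes_on_kernel)
    show "finite A" using E by (simp add: A_def)
    fix d assume d: "\<forall>i\<in>A. (\<Sum>e\<in>E. f i e * d e) = 0"
    have row: "(\<Sum>e\<in>{e\<in>E. fst e = u}. d e) = 0" for u
    proof (cases "u \<in> fst ` E")
      case True
      then have "(\<Sum>e\<in>E. f (Inl u) e * d e) = 0" using d by (auto simp: A_def)
      moreover have "(\<Sum>e\<in>E. f (Inl u) e * d e) = (\<Sum>e\<in>{e\<in>E. fst e = u}. d e)"
        by (rule sum.mono_neutral_cong_right) (use E in \<open>auto simp: f_def\<close>)
      ultimately show ?thesis by simp
    qed (auto intro!: sum.neutral)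
    have col: "(\<Sum>e\<in>{e\<in>E. snd e = v}. d e) = 0" for v
    proof (cases "v \<in> snd ` E")
      case True
      then have "(\<Sum>e\<in>E. f (Inr v) e * d e) = 0" using d by (auto simp: A_def)
      moreover have "(\<Sum>e\<in>E. f (Inr v) e * d e) = (\<Sum>e\<in>{e\<in>E. snd e = v}. d e)"
        by (rule sum.mono_neutral_cong_right) (use E in \<open>auto simp: f_def\<close>)
      ultimately show ?thesis by simp
    qed (auto intro!: sum.neutral)
    show "(\<Sum>e\<in>E. w e * d e) = 0" by (rule orth) (simp add: same_margins_def row col)
  qed fact
  then obtain c where c: "\<forall>e\<in>E. w e = (\<Sum>i\<in>A. c i * f i e)" by blast
  have "w (u, v) = c (Inl u) + c (Inr v)" if uv: "(u, v) \<in> E" for u v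
  proof -
    have fin: "finite (fst ` E)" "finite (snd ` E)" using E by auto
    have mem: "fst ` E \<inter> {u} = {u}" "snd ` E \<inter> {v} = {v}" using uv by force+
    have "w (u, v) = (\<Sum>u'\<in>fst ` E. c (Inl u') * of_bool (u = u')) + (\<Sum>v'\<in>snd ` E. c (Inr v') * of_bool (v = v'))"
      using c uv fin mem by (simp add: A_def sum.Plus f_def)
    also have "(\<Sum>u'\<in>fst ` E. c (Inl u') * of_bool (u = u')) = c (Inl u)"
      using fin mem by simp
    also have "(\<Sum>v'\<in>snd ` E. c (Inr v') * of_bool (v = v')) = c (Inr v)"
      using fin mem by simp
    finally show ?thesis .
  qed
  then show ?thesis by (intro exI[of _ "\<lambda>u. c (Inl u)"] exI[of _ "\<lambda>v. c (Inr v)"]) auto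
qed

text \<open>
  An entry of a nonnegative matrix is at most the total mass \<open>m\<close>, which the margins fix. Extended by
  zero off \<open>E\<close>, the competitors form a closed subset of a product of compact intervals, on which
  \<open>\<Sum> G ln G\<close> is continuous.
\<close>
lemma entropy_maximizer_exists:
  fixes B :: "'u \<times> 'v \<Rightarrow> real"
  assumes E: "finite E" and B: "\<And>e. e \<in> E \<Longrightarrow> 0 < B e"
  shows "\<exists>G. same_margins E G B \<and> (\<forall>e\<in>E. 0 \<le> G e) \<and>
    (\<forall>G'. same_margins E G' B \<and> (\<forall>e\<in>E. 0 \<le> G' e) \<longrightarrow>
       (\<Sum>e\<in>E. G e * ln (G e)) \<le> (\<Sum>e\<in>E. G' e * ln (G' e)))"
proof -
  define m where "m = (\<Sum>e\<in>E. B e)"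
  define K where "K = PiE UNIV (\<lambda>e. if e \<in> E then {0..m} else {0})"
  define P where "P = {G \<in> K. same_margins E G B}"
  have "compactin (product_topology (\<lambda>_. euclidean) UNIV) K"
    unfolding K_def by (subst compactin_PiE) auto
  then have "compact K" by (simp add: euclidean_product_topology)
  moreover have "closed {G. same_margins E G B}"
    unfolding same_margins_def
    by (intro closed_Collect_conj closed_Collect_all closed_Collect_eq continuous_intros continuous_on_sum)
       (auto intro: continuous_on_subset[OF continuous_on_product_coordinates])
  moreover have "P = K \<inter> {G. same_margins E G B}" by (auto simp: P_def)
  ultimately have "compact P" by (simp add: compact_Int_closed)
  have norm: "(\<lambda>e. if e \<in> E then G e else 0) \<in> P" if G: "same_margins E G B" "\<And>e. e \<in> E \<Longrightarrow> 0 \<le> G e" for G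
  proof -
    have "(\<Sum>e\<in>E. G e) = (\<Sum>u\<in>fst`E. \<Sum>e\<in>{e\<in>E. fst e = u}. G e)"
      using sum.image_gen[OF E, of G fst] .
    also have "\<dots> = (\<Sum>u\<in>fst`E. \<Sum>e\<in>{e\<in>E. fst e = u}. B e)" using G(1) by (simp add: same_margins_def)
    also have "\<dots> = m" unfolding m_def using sum.image_gen[OF E, of B fst] by simp
    finally have s: "(\<Sum>e\<in>E. G e) = m" .
    have "G e \<le> m" if "e \<in> E" for e unfolding s[symmetric] using that E G(2) by (intro member_le_sum) auto
    moreover have "same_margins E (\<lambda>e. if e \<in> E then G e else 0) B"
      using G(1) by (subst same_margins_cong[of E _ G B B]) auto
    ultimately show ?thesis using G(2) by (auto simp: P_def K_def)
  qed
  have "(\<lambda>e. if e \<in> E then B e else 0) \<in> P" by (rule norm) (auto simp: same_margins_def B less_imp_le)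
  then have "P \<noteq> {}" by blast
  have P_nonneg: "0 \<le> G e" if "G \<in> P" "e \<in> E" for G e
  proof -
    have "G e \<in> (if e \<in> E then {0..m} else {0})"
      using that by (intro PiE_mem[of G UNIV]) (auto simp: P_def K_def)
    with \<open>e \<in> E\<close> show ?thesis by simp
  qed
  have "continuous_on P (\<lambda>G. \<Sum>e\<in>E. G e * ln (G e))"
  proof (intro continuous_on_sum)
    fix e assume "e \<in> E"
    have "continuous_on P (\<lambda>G. G e)"
      by (rule continuous_on_subset[OF continuous_on_product_coordinates]) auto
    moreover have "(\<lambda>G. G e) ` P \<subseteq> {0..}" using P_nonneg[OF _ \<open>e \<in> E\<close>] by auto
    ultimately show "continuous_on P (\<lambda>G. G e * ln (G e))"
      using continuous_on_compose2[OF continuous_on_times_ln] by blast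
  qed
  from continuous_attains_inf[OF \<open>compact P\<close> \<open>P \<noteq> {}\<close> this]
  obtain G where G: "G \<in> P" and opt: "\<And>G'. G' \<in> P \<Longrightarrow> (\<Sum>e\<in>E. G e * ln (G e)) \<le> (\<Sum>e\<in>E. G' e * ln (G' e))"
    by blast
  show ?thesis
  proof (intro exI[of _ G] conjI ballI allI impI)
    show "same_margins E G B" using G by (simp add: P_def)
    show "0 \<le> G e" if "e \<in> E" for e using P_nonneg[OF G that] .
    fix G' assume "same_margins E G' B \<and> (\<forall>e\<in>E. 0 \<le> G' e)"
    then have "(\<lambda>e. if e \<in> E then G' e else 0) \<in> P" by (intro norm) auto
    from opt[OF this] show "(\<Sum>e\<in>E. G e * ln (G e)) \<le> (\<Sum>e\<in>E. G' e * ln (G' e))"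
      by (simp cong: sum.cong)
  qed
qed

text \<open>
  The slope of \<open>t ln t\<close> at \<open>0\<close> is \<open>-\<infinity>\<close>: moving from \<open>G\<close> by a fraction \<open>\<epsilon>\<close> towards \<open>B\<close> changes
  \<open>\<Sum> G ln G\<close> by at most \<open>\<epsilon>\<close> times a constant by convexity, but a vanishing entry \<open>e0\<close> contributes
  the extra term \<open>\<epsilon> B(e0) ln \<epsilon>\<close>, which wins for small \<open>\<epsilon>\<close>.
\<close>
lemma entropy_maximizer_positive:
  fixes B :: "'u \<times> 'v \<Rightarrow> real"
  assumes E: "finite E" and B: "\<And>e. e \<in> E \<Longrightarrow> 0 < B e"
    and G: "same_margins E G B" "\<And>e. e \<in> E \<Longrightarrow> 0 \<le> G e"
    and opt: "\<And>G'. same_margins E G' B \<Longrightarrow> (\<And>e. e \<in> E \<Longrightarrow> 0 \<le> G' e) \<Longrightarrow>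
       (\<Sum>e\<in>E. G e * ln (G e)) \<le> (\<Sum>e\<in>E. G' e * ln (G' e))"
    and e0: "e0 \<in> E"
  shows "0 < G e0"
proof (rule ccontr)
  assume "\<not> 0 < G e0"
  with G(2)[OF e0] have z: "G e0 = 0" by simp
  define S where "S = (\<lambda>G :: 'u \<times> 'v \<Rightarrow> real. \<Sum>e\<in>E. G e * ln (G e))"
  have bound: "S G \<le> S B + B e0 * ln \<epsilon>" if \<epsilon>: "0 < \<epsilon>" "\<epsilon> < 1" for \<epsilon>
  proof -
    define M where "M = (\<lambda>e. (1 - \<epsilon>) * G e + \<epsilon> * B e)"
    have sumM: "sum M X = (1 - \<epsilon>) * sum G X + \<epsilon> * sum B X" for X
      by (simp add: M_def sum.distrib sum_distrib_left)
    have "S G \<le> S M"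
      unfolding S_def
    proof (rule opt)
      show "same_margins E M B"
        using G(1) by (simp add: same_margins_def sumM algebra_simps)
      show "0 \<le> M e" if "e \<in> E" for e using G(2)[OF that] B[OF that] \<epsilon> by (simp add: M_def)
    qed
    also have "S M \<le> (\<Sum>e\<in>E. (1 - \<epsilon>) * (G e * ln (G e)) + \<epsilon> * (B e * ln (B e)) + (if e = e0 then \<epsilon> * B e0 * ln \<epsilon> else 0))"
      unfolding S_def
    proof (rule sum_mono)
      fix e assume e: "e \<in> E"
      show "M e * ln (M e) \<le> (1 - \<epsilon>) * (G e * ln (G e)) + \<epsilon> * (B e * ln (B e)) + (if e = e0 then \<epsilon> * B e0 * ln \<epsilon> else 0)"
        using convex_times_ln_mix[OF G(2)[OF e] B[OF e] \<epsilon>] z B[OF e0] \<epsilon>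
        by (auto simp: M_def ln_mult algebra_simps)
    qed
    also have "\<dots> = (1 - \<epsilon>) * S G + \<epsilon> * S B + \<epsilon> * B e0 * ln \<epsilon>"
      using E e0 by (simp add: sum.distrib S_def sum_distrib_left)
    finally have "\<epsilon> * S G \<le> \<epsilon> * (S B + B e0 * ln \<epsilon>)" by (simp add: algebra_simps)
    then show ?thesis using \<epsilon> by simp
  qed
  \<comment> \<open>Chosen such that \<open>B e0 * ln \<epsilon> = - (\<bar>S B - S G\<bar> + 1)\<close>.\<close>
  define \<epsilon> where "\<epsilon> = exp (- (\<bar>S B - S G\<bar> + 1) / B e0)"
  have "0 < \<epsilon>" "\<epsilon> < 1" using B[OF e0] by (auto simp: \<epsilon>_def intro!: divide_neg_pos)
  from bound[OF this] show False using B[OF e0] by (simp add: \<epsilon>_def)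
qed

text \<open>
  The first-order condition along \<open>G + t d\<close>, which is a competitor for small \<open>t\<close> of either sign
  because \<open>G\<close> is positive. The derivative of \<open>t ln t\<close> is \<open>ln t + 1\<close>, and the constant \<open>1\<close> drops out
  because \<open>d\<close> has total mass zero.
\<close>
lemma log_entropy_maximizer_orthogonal:
  fixes B :: "'u \<times> 'v \<Rightarrow> real"
  assumes E: "finite E"
    and G: "same_margins E G B" "\<And>e. e \<in> E \<Longrightarrow> 0 < G e"
    and opt: "\<And>G'. same_margins E G' B \<Longrightarrow> (\<And>e. e \<in> E \<Longrightarrow> 0 \<le> G' e) \<Longrightarrow>
       (\<Sum>e\<in>E. G e * ln (G e)) \<le> (\<Sum>e\<in>E. G' e * ln (G' e))"
    and d: "same_margins E d (\<lambda>_. 0)"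
  shows "(\<Sum>e\<in>E. ln (G e) * d e) = 0"
proof -
  define F where "F = (\<lambda>t. \<Sum>e\<in>E. (G e + t * d e) * ln (G e + t * d e))"
  have "(F has_real_derivative (\<Sum>e\<in>E. (ln (G e) + 1) * d e)) (at 0)"
    unfolding F_def
  proof (rule DERIV_sum)
    fix e assume e: "e \<in> E"
    show "((\<lambda>t. (G e + t * d e) * ln (G e + t * d e)) has_real_derivative (ln (G e) + 1) * d e) (at 0)"
      using G(2)[OF e] by (auto intro!: derivative_eq_intros simp: algebra_simps)
  qed
  moreover have "\<exists>\<delta>>0. \<forall>t. \<bar>0 - t\<bar> < \<delta> \<longrightarrow> F 0 \<le> F t"
  proof -
    have "\<forall>e\<in>E. \<forall>\<^sub>F t in nhds 0. 0 < G e + t * d e"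
    proof
      fix e assume e: "e \<in> E"
      have "((\<lambda>t. G e + t * d e) \<longlongrightarrow> G e + 0 * d e) (nhds 0)"
        by (intro tendsto_intros) (auto simp: filterlim_ident)
      then show "\<forall>\<^sub>F t in nhds 0. 0 < G e + t * d e"
        using G(2)[OF e] by (auto dest: order_tendstoD(1))
    qed
    then have "\<forall>\<^sub>F t in nhds 0. \<forall>e\<in>E. 0 < G e + t * d e"
      using E by (simp add: eventually_ball_finite)
    then obtain \<delta> where "\<delta> > 0" and \<delta>: "\<And>t e. \<bar>t\<bar> < \<delta> \<Longrightarrow> e \<in> E \<Longrightarrow> 0 < G e + t * d e"
      by (auto simp: eventually_nhds_metric dist_real_def)
    have "F 0 \<le> F t" if "\<bar>t\<bar> < \<delta>" for t
      using opt[of "\<lambda>e. G e + t * d e"] G(1) d \<delta>[OF that]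
      by (auto simp: F_def same_margins_def sum.distrib less_imp_le simp flip: sum_distrib_left)
    with \<open>\<delta> > 0\<close> show ?thesis by auto
  qed
  ultimately have "(\<Sum>e\<in>E. (ln (G e) + 1) * d e) = 0"
    using DERIV_local_min by blast
  moreover have "(\<Sum>e\<in>E. d e) = 0"
    using sum.image_gen[OF E, of d fst] d by (simp add: same_margins_def)
  ultimately show ?thesis by (simp add: algebra_simps sum.distrib)
qed

text \<open>
  The logarithm of the matrix of maximal entropy is additive, so the matrix itself is a product of
  a row factor and a column factor on the support.
\<close>
theorem matrix_scaling:
  fixes B :: "'u \<times> 'v \<Rightarrow> real"
  assumes E: "finite E" and B: "\<And>e. e \<in> E \<Longrightarrow> 0 < B e"
  shows "\<exists>lam mu. (\<forall>u. 0 < lam u) \<and> (\<forall>v. 0 < mu v) \<and> same_margins E (\<lambda>(u, v). lam u * mu v) B"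
proof -
  have "\<exists>G. same_margins E G B \<and> (\<forall>e\<in>E. 0 \<le> G e) \<and>
    (\<forall>G'. same_margins E G' B \<and> (\<forall>e\<in>E. 0 \<le> G' e) \<longrightarrow>
       (\<Sum>e\<in>E. G e * ln (G e)) \<le> (\<Sum>e\<in>E. G' e * ln (G' e)))"
    by (rule entropy_maximizer_exists[OF E B])
  then obtain G where G: "same_margins E G B" "\<And>e. e \<in> E \<Longrightarrow> 0 \<le> G e"
    and opt: "\<And>G'. same_margins E G' B \<Longrightarrow> (\<And>e. e \<in> E \<Longrightarrow> 0 \<le> G' e) \<Longrightarrow>
       (\<Sum>e\<in>E. G e * ln (G e)) \<le> (\<Sum>e\<in>E. G' e * ln (G' e))"
    by (elim exE conjE) simp
  have pos: "0 < G e" if "e \<in> E" for e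
    by (rule entropy_maximizer_positive[OF E B G opt that])
  have "\<exists>\<alpha> \<beta>. \<forall>(u, v)\<in>E. ln (G (u, v)) = \<alpha> u + \<beta> v"
  proof (rule additive_if_orthogonal_to_zero_margins[OF E])
    fix d :: "'u \<times> 'v \<Rightarrow> real" assume d: "same_margins E d (\<lambda>_. 0)"
    show "(\<Sum>e\<in>E. ln (G e) * d e) = 0"
      by (rule log_entropy_maximizer_orthogonal[OF E G(1) pos opt d])
  qed
  then obtain \<alpha> \<beta> where ab: "\<forall>(u, v)\<in>E. ln (G (u, v)) = \<alpha> u + \<beta> v" by blast
  have exp_eq: "exp (\<alpha> u) * exp (\<beta> v) = G (u, v)" if uv: "(u, v) \<in> E" for u v
  proof -
    have "\<alpha> u + \<beta> v = ln (G (u, v))" using ab uv by auto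
    then have "exp (\<alpha> u) * exp (\<beta> v) = exp (ln (G (u, v)))" by (simp flip: exp_add)
    then show ?thesis using pos[OF uv] by simp
  qed
  have "same_margins E (\<lambda>(u, v). exp (\<alpha> u) * exp (\<beta> v)) B"
    using G(1) by (subst same_margins_cong[of E _ G B B]) (auto simp: exp_eq)
  then show ?thesis
    by (intro exI[of _ "\<lambda>u. exp (\<alpha> u)"] exI[of _ "\<lambda>v. exp (\<beta> v)"]) simp
qed

text \<open>
  The sum of the two relative entropies of \<open>G\<close> and \<open>G'\<close> equals \<open>\<Sum> (ln G - ln G') (G - G')\<close>. The first
  factor is additive in row and column and the second has zero margins, so the sum vanishes, and
  Gibbs' inequality is an equality in every entry.
\<close>
lemma scaled_matrix_unique:
  assumes E: "finite E"
    and pos: "\<And>u v. (u, v) \<in> E \<Longrightarrow> 0 < lam u \<and> 0 < mu v \<and> 0 < lam' u \<and> 0 < mu' v"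
    and same: "same_margins E (\<lambda>(u, v). lam u * mu v) (\<lambda>(u, v). lam' u * mu' v)"
    and uv: "(u, v) \<in> E"
  shows "lam u * mu v = lam' u * (mu' v :: real)"
proof -
  define G where "G = (\<lambda>(u, v). lam u * mu v)"
  define G' where "G' = (\<lambda>(u, v). lam' u * mu' v)"
  define d where "d = (\<lambda>e. G e - G' e)"
  have Gpos: "0 < G e" "0 < G' e" if "e \<in> E" for e using pos that by (auto simp: G_def G'_def split: prod.split)
  have d0: "same_margins E d (\<lambda>_. 0)"
    using same unfolding G_def[symmetric] G'_def[symmetric] by (simp add: same_margins_def d_def sum_subtractf)
  have row: "(\<Sum>e\<in>E. r (fst e) * d e) = 0" for r
  proof -
    have "(\<Sum>e\<in>E. r (fst e) * d e) = (\<Sum>u\<in>fst`E. \<Sum>e\<in>{e\<in>E. fst e = u}. r (fst e) * d e)"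
      by (rule sum.image_gen[OF E])
    also have "\<dots> = (\<Sum>u\<in>fst`E. r u * (\<Sum>e\<in>{e\<in>E. fst e = u}. d e))"
      by (auto simp: sum_distrib_left intro!: sum.cong)
    also have "\<dots> = 0" using d0 by (simp add: same_margins_def)
    finally show ?thesis .
  qed
  have col: "(\<Sum>e\<in>E. r (snd e) * d e) = 0" for r
  proof -
    have "(\<Sum>e\<in>E. r (snd e) * d e) = (\<Sum>u\<in>snd`E. \<Sum>e\<in>{e\<in>E. snd e = u}. r (snd e) * d e)"
      by (rule sum.image_gen[OF E])
    also have "\<dots> = (\<Sum>u\<in>snd`E. r u * (\<Sum>e\<in>{e\<in>E. snd e = u}. d e))"
      by (auto simp: sum_distrib_left intro!: sum.cong)
    also have "\<dots> = 0" using d0 by (simp add: same_margins_def)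
    finally show ?thesis .
  qed
  define T where "T = (\<lambda>a b :: real. a * ln a - a * ln b - a + b)"
  have T0: "0 \<le> T a b" if "0 < a" "0 < b" for a b using gibbs_pointwise(1) that by (simp add: T_def)
  have "(\<Sum>e\<in>E. T (G e) (G' e) + T (G' e) (G e)) = (\<Sum>e\<in>E. (ln (lam (fst e)) - ln (lam' (fst e))) * d e + (ln (mu (snd e)) - ln (mu' (snd e))) * d e)"
  proof (rule sum.cong)
    fix e assume e: "e \<in> E"
    have "ln (G e) = ln (lam (fst e)) + ln (mu (snd e))" "ln (G' e) = ln (lam' (fst e)) + ln (mu' (snd e))"
      using pos[of "fst e" "snd e"] e by (auto simp: G_def G'_def split_beta ln_mult)
    then show "T (G e) (G' e) + T (G' e) (G e) = (ln (lam (fst e)) - ln (lam' (fst e))) * d e + (ln (mu (snd e)) - ln (mu' (snd e))) * d e"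
      by (simp add: T_def d_def algebra_simps)
  qed simp
  also have "\<dots> = 0" using row[of "\<lambda>u. ln (lam u) - ln (lam' u)"] col[of "\<lambda>v. ln (mu v) - ln (mu' v)"]
    by (simp add: sum.distrib)
  finally have "\<forall>e\<in>E. T (G e) (G' e) + T (G' e) (G e) = 0"
    using E T0 Gpos by (subst (asm) sum_nonneg_eq_0_iff) (auto intro!: add_nonneg_nonneg)
  then have "T (G (u, v)) (G' (u, v)) = 0" using uv T0 Gpos by (smt (verit))
  then have "G (u, v) = G' (u, v)"
    using gibbs_pointwise(2)[of "G (u, v)" "G' (u, v)"] Gpos[OF uv] unfolding T_def by linarith
  then show ?thesis by (simp add: G_def G'_def)
qed

section \<open>Permutons and their height functions\<close>

abbreviation square_lborel :: "(real \<times> real) measure" where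
  "square_lborel \<equiv> restrict_space lborel unit_square"

lemma unit_square_borel [measurable]: "unit_square \<in> sets borel"
  unfolding unit_square_def by (intro borel_closed closed_Times) auto

lemma sets_square_lborel: "sets square_lborel = sets (restrict_space borel unit_square)"
  by (intro sets_restrict_space_cong) simp

lemma borel_measurable_square_lborel:
  "borel_measurable square_lborel = borel_measurable (restrict_space borel unit_square)"
  by (intro measurable_cong_sets sets_square_lborel refl)

lemma space_square_lborel: "space square_lborel = unit_square"
  by (simp add: space_restrict_space)

lemma
  shows borel_measurable_fst_square [measurable]: "fst \<in> borel_measurable (restrict_space borel unit_square)"
    and borel_measurable_snd_square [measurable]: "snd \<in> borel_measurable (restrict_space borel unit_square)"
    by (auto intro!: measurable_restrict_space1 borel_measurable_continuous_onI continuous_intros)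

lemma Times_in_sets_square:
  assumes "A \<in> sets borel" "B \<in> sets borel" "A \<subseteq> {0..1}" "B \<subseteq> {0..1}"
  shows "A \<times> B \<in> sets (restrict_space borel unit_square)"
proof -
  have "A \<times> B \<in> sets borel"
    using assms(1,2) by (metis borel_prod pair_measureI)
  moreover have "A \<times> B \<subseteq> unit_square" using assms(3,4) by (auto simp: unit_square_def)
  ultimately show ?thesis by (simp add: sets_restrict_space_iff)
qed

context
  fixes M :: "(real \<times> real) measure"
  assumes M: "permuton M"
begin

lemma prob_space_permuton: "prob_space M"
  using M by (simp add: permuton_def)

interpretation prob_space M by (rule prob_space_permuton)

lemma sets_permuton: "sets M = sets (restrict_space borel unit_square)"
  using M by (simp add: permuton_def)

lemma space_permuton: "space M = unit_square"
  using sets_eq_imp_space_eq[OF sets_permuton] by (simp add: space_restrict_space)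

lemma permuton_rect_sets:
  "A \<in> sets borel \<Longrightarrow> B \<in> sets borel \<Longrightarrow> A \<subseteq> {0..1} \<Longrightarrow> B \<subseteq> {0..1} \<Longrightarrow> A \<times> B \<in> sets M"
  unfolding sets_permuton by (rule Times_in_sets_square)

lemma
  assumes A: "A \<in> sets borel" "A \<subseteq> {0..1}"
  shows permuton_vertical_strip: "measure M (A \<times> {0..1}) = measure lborel A"
    and permuton_horizontal_strip: "measure M ({0..1} \<times> A) = measure lborel A"
proof -
  have [measurable]: "fst \<in> borel_measurable M" "snd \<in> borel_measurable M"
    by (simp_all add: measurable_cong_sets[OF sets_permuton refl])
  have u: "measure (uniform_measure lborel {0..1::real}) A = measure lborel A"
  proof -
    have "emeasure (uniform_measure lborel {0..1::real}) A = emeasure lborel A"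
      using A by (simp add: Int_absorb1 divide_ennreal_def)
    then show ?thesis by (simp add: measure_def)
  qed
  have "measure (distr M borel fst) A = measure M (A \<times> {0..1})"
    using A by (subst measure_distr) (auto intro!: arg_cong[of _ _ "measure M"] simp: space_permuton unit_square_def)
  then show "measure M (A \<times> {0..1}) = measure lborel A" using M u by (simp add: permuton_def)
  have "measure (distr M borel snd) A = measure M ({0..1} \<times> A)"
    using A by (subst measure_distr) (auto intro!: arg_cong[of _ _ "measure M"] simp: space_permuton unit_square_def)
  then show "measure M ({0..1} \<times> A) = measure lborel A" using M u by (simp add: permuton_def)
qed

lemma permuton_rect_le:
  assumes "A \<in> sets borel" "B \<in> sets borel" "A \<subseteq> {0..1}" "B \<subseteq> {0..1}"
  shows "measure M (A \<times> B) \<le> measure lborel A" "measure M (A \<times> B) \<le> measure lborel B"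
proof -
  have "measure M (A \<times> B) \<le> measure M (A \<times> {0..1})"
    using assms by (intro finite_measure_mono permuton_rect_sets) auto
  then show "measure M (A \<times> B) \<le> measure lborel A" using assms permuton_vertical_strip by simp
  have "measure M (A \<times> B) \<le> measure M ({0..1} \<times> B)"
    using assms by (intro finite_measure_mono permuton_rect_sets) auto
  then show "measure M (A \<times> B) \<le> measure lborel B" using assms permuton_horizontal_strip by simp
qed

lemma permuton_rect_split_fst:
  assumes "A \<in> sets borel" "A' \<in> sets borel" "B \<in> sets borel" "A \<union> A' \<subseteq> {0..1}" "B \<subseteq> {0..1}" "A \<inter> A' = {}"
  shows "measure M ((A \<union> A') \<times> B) = measure M (A \<times> B) + measure M (A' \<times> B)"
proof -
  have "(A \<union> A') \<times> B = A \<times> B \<union> A' \<times> B" by auto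
  then show ?thesis using assms
    by (simp only:) (intro finite_measure_Union permuton_rect_sets, auto)
qed

lemma permuton_rect_split_snd:
  assumes "A \<in> sets borel" "B \<in> sets borel" "B' \<in> sets borel" "A \<subseteq> {0..1}" "B \<union> B' \<subseteq> {0..1}" "B \<inter> B' = {}"
  shows "measure M (A \<times> (B \<union> B')) = measure M (A \<times> B) + measure M (A \<times> B')"
proof -
  have "A \<times> (B \<union> B') = A \<times> B \<union> A \<times> B'" by auto
  then show ?thesis using assms
    by (simp only:) (intro finite_measure_Union permuton_rect_sets, auto)
qed

end

context
  fixes M :: "(real \<times> real) measure" and h :: "real \<times> real \<Rightarrow> real"
  assumes hM: "permuton_of h M"
begin

lemma permuton_of_imp_permuton: "permuton M" using hM by (simp add: permuton_of_def)

lemma height_eq: "s \<in> {0..1} \<Longrightarrow> t \<in> {0..1} \<Longrightarrow> h (s, t) = measure M ({s..1} \<times> {0..t})"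
  using hM by (simp add: permuton_of_def)

text \<open>
  Vertical lines are null sets. This allows the use of half-open rectangles, which
  partition the square.
\<close>
lemma height_eq_open:
  assumes "s \<in> {0..1}" "t \<in> {0..1}"
  shows "h (s, t) = measure M ({s<..1} \<times> {0..t})"
proof -
  have "measure M (({s} \<union> {s<..1}) \<times> {0..t}) = measure M ({s} \<times> {0..t}) + measure M ({s<..1} \<times> {0..t})"
    using assms by (intro permuton_rect_split_fst[OF permuton_of_imp_permuton]) auto
  moreover have "{s} \<union> {s<..1} = {s..1}" using assms by auto
  moreover have "measure M ({s} \<times> {0..t}) = 0"
    using permuton_rect_le(1)[OF permuton_of_imp_permuton, of "{s}" "{0..t}"] assms measure_nonneg[of M "{s} \<times> {0..t}"] by simp
  ultimately show ?thesis using height_eq[OF assms] by simp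
qed

lemma height_diff_fst:
  assumes "0 \<le> s1" "s1 \<le> s2" "s2 \<le> 1" "t \<in> {0..1}"
  shows "h (s1, t) - h (s2, t) = measure M ({s1<..s2} \<times> {0..t})"
proof -
  have "measure M (({s1<..s2} \<union> {s2<..1}) \<times> {0..t}) = measure M ({s1<..s2} \<times> {0..t}) + measure M ({s2<..1} \<times> {0..t})"
    using assms by (intro permuton_rect_split_fst[OF permuton_of_imp_permuton]) auto
  moreover have "{s1<..s2} \<union> {s2<..1} = {s1<..1}" using assms by auto
  ultimately show ?thesis using height_eq_open assms by simp
qed

lemma height_diff_snd:
  assumes "s \<in> {0..1}" "0 \<le> t1" "t1 \<le> t2" "t2 \<le> 1"
  shows "h (s, t2) - h (s, t1) = measure M ({s..1} \<times> {t1<..t2})"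
proof -
  have "measure M ({s..1} \<times> ({0..t1} \<union> {t1<..t2})) = measure M ({s..1} \<times> {0..t1}) + measure M ({s..1} \<times> {t1<..t2})"
    using assms by (intro permuton_rect_split_snd[OF permuton_of_imp_permuton]) auto
  moreover have "{0..t1} \<union> {t1<..t2} = {0..t2}" using assms by auto
  ultimately show ?thesis using height_eq assms by simp
qed

lemma height_rect:
  assumes "0 \<le> s1" "s1 \<le> s2" "s2 \<le> 1" "0 \<le> t1" "t1 \<le> t2" "t2 \<le> 1"
  shows "h (s2, t2) + h (s1, t1) - h (s2, t1) - h (s1, t2) = - measure M ({s1<..s2} \<times> {t1<..t2})"
proof -
  have "measure M ({s1<..s2} \<times> ({0..t1} \<union> {t1<..t2})) = measure M ({s1<..s2} \<times> {0..t1}) + measure M ({s1<..s2} \<times> {t1<..t2})"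
    using assms by (intro permuton_rect_split_snd[OF permuton_of_imp_permuton]) auto
  moreover have "{0..t1} \<union> {t1<..t2} = {0..t2}" using assms by auto
  ultimately show ?thesis
    using height_diff_fst[of s1 s2 t1] height_diff_fst[of s1 s2 t2] assms by simp
qed

lemma permuton_of_in_height_functions:
  assumes ext: "h \<in> extensional unit_square"
  shows "h \<in> height_functions"
proof -
  have lip_fst: "\<bar>h (s, t) - h (s', t)\<bar> \<le> s' - s" if "0 \<le> s" "s \<le> s'" "s' \<le> 1" "t \<in> {0..1}" for s s' t
  proof -
    have "measure M ({s<..s'} \<times> {0..t}) \<le> measure lborel {s<..s'}"
      using that by (intro permuton_rect_le[OF permuton_of_imp_permuton]) auto
    then show ?thesis using height_diff_fst[OF that] that by (simp add: measure_nonneg)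
  qed
  have lip_snd: "\<bar>h (s, t) - h (s, t')\<bar> \<le> t' - t" if "s \<in> {0..1}" "0 \<le> t" "t \<le> t'" "t' \<le> 1" for s t t'
  proof -
    have "measure M ({s..1} \<times> {t<..t'}) \<le> measure lborel {t<..t'}"
      using that by (intro permuton_rect_le[OF permuton_of_imp_permuton]) auto
    then have "measure M ({s..1} \<times> {t<..t'}) \<le> t' - t" using that by simp
    then show ?thesis
      using height_diff_snd[OF that] measure_nonneg[of M "{s..1} \<times> {t<..t'}"] by linarith
  qed
  have L1: "1-lipschitz_on {0..1} (\<lambda>s. h (s, t))" if "t \<in> {0..1}" for t
  proof (rule lipschitz_onI)
    fix a b :: real assume "a \<in> {0..1}" "b \<in> {0..1}"
    then show "dist (h (a, t)) (h (b, t)) \<le> 1 * dist a b"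
      using lip_fst[of a b t] lip_fst[of b a t] that by (cases "a \<le> b") (auto simp: dist_real_def)
  qed simp
  have L2: "1-lipschitz_on {0..1} (\<lambda>t. h (s, t))" if "s \<in> {0..1}" for s
  proof (rule lipschitz_onI)
    fix a b :: real assume "a \<in> {0..1}" "b \<in> {0..1}"
    then show "dist (h (s, a)) (h (s, b)) \<le> 1 * dist a b"
      using lip_snd[of s a b] lip_snd[of s b a] that by (cases "a \<le> b") (auto simp: dist_real_def)
  qed simp
  have rect: "h (s1, t1) + h (s2, t2) - h (s1, t2) - h (s2, t1) \<le> 0"
    if "0 \<le> s1 \<and> s1 < s2 \<and> s2 \<le> 1 \<and> 0 \<le> t1 \<and> t1 < t2 \<and> t2 \<le> 1" for s1 s2 t1 t2
    using height_rect[of s1 s2 t1 t2] that measure_nonneg[of M "{s1<..s2} \<times> {t1<..t2}"] by linarith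
  have s0: "h (s, 0) = 0" if "s \<in> {0..1}" for s
    using permuton_rect_le(2)[OF permuton_of_imp_permuton, of "{s..1}" "{0..0}"] that height_eq[of s 0] measure_nonneg[of M "{s..1} \<times> {0}"] by simp
  have s1: "h (s, 1) = 1 - s" if "s \<in> {0..1}" for s
    using permuton_vertical_strip[OF permuton_of_imp_permuton, of "{s..1}"] that height_eq[of s 1] by simp
  have t0: "h (0, t) = t" if "t \<in> {0..1}" for t
    using permuton_horizontal_strip[OF permuton_of_imp_permuton, of "{0..t}"] that height_eq[of 0 t] by simp
  have t1: "h (1, t) = 0" if "t \<in> {0..1}" for t
    using permuton_rect_le(1)[OF permuton_of_imp_permuton, of "{1..1}" "{0..t}"] that height_eq[of 1 t] measure_nonneg[of M "{1} \<times> {0..t}"] by simp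
  show ?thesis unfolding height_functions_def
    using ext L1 L2 rect s0 s1 t0 t1 by blast
qed

end

text \<open>
  The quadrants \<open>{..(s, t)}\<close> generate the Borel sets of the plane and are stable under
  intersection, so a permuton, viewed as a measure on the plane, is determined by their measures,
  which the height function gives.
\<close>
lemma permuton_of_unique:
  assumes hM: "permuton_of h M" and hN: "permuton_of h N"
  shows "M = N"
proof -
  have sets: "sets M = sets N"
    using sets_permuton[OF permuton_of_imp_permuton[OF hM]] sets_permuton[OF permuton_of_imp_permuton[OF hN]] by simp
  \<comment> \<open>A quadrant is a horizontal strip without the rectangle that the height function measures.\<close>
  have quad: "measure L ({0..s} \<times> {0..t}) = t - h (s, t)"
    if L: "permuton_of h L" and st: "s \<in> {0..1}" "t \<in> {0..1}" for L s t
  proof -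
    have "measure L (({0..s} \<union> {s<..1}) \<times> {0..t}) = measure L ({0..s} \<times> {0..t}) + measure L ({s<..1} \<times> {0..t})"
      using st by (intro permuton_rect_split_fst[OF permuton_of_imp_permuton[OF L]]) auto
    moreover have "{0..s} \<union> {s<..1} = {0..1}" using st by auto
    ultimately show ?thesis
      using height_eq_open[OF L st] permuton_horizontal_strip[OF permuton_of_imp_permuton[OF L], of "{0..t}"] st by simp
  qed
  have idm: "(\<lambda>z. z) \<in> measurable L borel" if "permuton_of h L" for L
    using sets_permuton[OF permuton_of_imp_permuton[OF that]]
    by (subst measurable_cong_sets[OF _ refl]) (auto intro: measurable_restrict_space1)
  \<comment> \<open>Clipping to the square reduces all quadrants of the plane to those with corner in the square.\<close>
  have em: "emeasure (distr L borel (\<lambda>z. z)) {..(s, t)} =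
      (if s < 0 \<or> t < 0 then 0 else ennreal (min t 1 - h (min s 1, min t 1)))"
    if L: "permuton_of h L" for L s t
  proof -
    interpret prob_space L by (rule prob_space_permuton[OF permuton_of_imp_permuton[OF L]])
    have "emeasure (distr L borel (\<lambda>z. z)) {..(s, t)} = emeasure L ({..(s, t)} \<inter> unit_square)"
      using idm[OF L] by (subst emeasure_distr) (auto simp: space_permuton[OF permuton_of_imp_permuton[OF L]])
    also have "{..(s, t)} \<inter> unit_square = (if s < 0 \<or> t < 0 then {} else {0..min s 1} \<times> {0..min t 1})"
      by (auto simp: unit_square_def less_eq_prod_def)
    finally show ?thesis
      using quad[OF L, of "min s 1" "min t 1"] by (auto simp: emeasure_eq_measure)
  qed
  have "distr M borel (\<lambda>z. z) = distr N borel (\<lambda>z. z)"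
  proof (rule measure_eqI_generator_eq[where \<Omega> = UNIV and E = "range atMost" and A = "\<lambda>n::nat. {..(real n, real n)}"])
    show "Int_stable (range (atMost :: real \<times> real \<Rightarrow> _))"
      unfolding Int_stable_def
    proof (intro ballI, elim imageE, clarify)
      fix a b c d :: real
      have "{..(a, b)} \<inter> {..(c, d)} = {..(min a c, min b d)}" by (auto simp: less_eq_prod_def)
      then show "{..(a, b)} \<inter> {..(c, d)} \<in> range atMost" by simp
    qed
    show "emeasure (distr M borel (\<lambda>z. z)) X = emeasure (distr N borel (\<lambda>z. z)) X" if "X \<in> range atMost" for X
      using that em[OF hM] em[OF hN] by force
    show "sets (distr M borel (\<lambda>z. z)) = sigma_sets UNIV (range atMost)"
      "sets (distr N borel (\<lambda>z. z)) = sigma_sets UNIV (range atMost)"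
      by (simp_all add: borel_eq_atMost)
    show "(\<Union>n. {..(real n, real n)}) = UNIV"
    proof (intro set_eqI iffI UNIV_I)
      fix z :: "real \<times> real"
      obtain n :: nat where "max (fst z) (snd z) \<le> real n" using real_arch_simple by blast
      then show "z \<in> (\<Union>n. {..(real n, real n)})" by (auto simp: less_eq_prod_def)
    qed
    show "emeasure (distr M borel (\<lambda>z. z)) {..(real n, real n)} \<noteq> \<infinity>" for n
      using em[OF hM, of n n] by simp
  qed auto
  then have eq: "emeasure (distr M borel (\<lambda>z. z)) A = emeasure (distr N borel (\<lambda>z. z)) A" for A by simp
  show ?thesis
  proof (rule measure_eqI[OF sets])
    fix A assume A: "A \<in> sets M"
    then have "A \<in> sets (restrict_space borel unit_square)"
      using sets_permuton[OF permuton_of_imp_permuton[OF hM]] by simp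
    then have A': "A \<in> sets borel" "A \<subseteq> unit_square" by (simp_all add: sets_restrict_space_iff)
    have "emeasure (distr L borel (\<lambda>z. z)) A = emeasure L A" if "permuton_of h L" for L
      using idm[OF that] A' space_permuton[OF permuton_of_imp_permuton[OF that]]
      by (subst emeasure_distr) (auto simp: Int_absorb2)
    then show "emeasure M A = emeasure N A" using eq hM hN by metis
  qed
qed

section \<open>Energy of permutons with a product density\<close>

lemma permuton_densityD:
  assumes "permuton_density h g"
  shows "g \<in> borel_measurable square_lborel" "\<And>z. z \<in> unit_square \<Longrightarrow> 0 \<le> g z"
    "permuton_of h (density square_lborel (\<lambda>z. ennreal (g z)))"
    "AE z in square_lborel. 0 \<le> g z"
  using assms unfolding permuton_density_def borel_measurable_square_lborel
  by (auto intro!: AE_I2 simp: space_square_lborel)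

lemma permuton_density_integral_one:
  assumes "permuton_density h g"
  shows "integrable square_lborel g" "(LINT z|square_lborel. g z) = 1"
proof -
  note g [measurable] = permuton_densityD[OF assms]
  define M where "M = density square_lborel (\<lambda>z. ennreal (g z))"
  interpret prob_space M unfolding M_def by (rule prob_space_permuton[OF permuton_of_imp_permuton[OF g(3)]])
  have "integrable M (\<lambda>_. 1 :: real)" by simp
  then show "integrable square_lborel g"
    unfolding M_def using g(1,4) by (subst (asm) integrable_density) auto
  have "(LINT z|M. 1) = (1 :: real)" by (simp add: prob_space)
  then show "(LINT z|square_lborel. g z) = 1"
    unfolding M_def using g(1,4) by (subst (asm) integral_density) auto
qed

text \<open>
  These integrals are expectations of functions of one coordinate, and all permutons have uniform
  margins. This makes the cross-entropy of every competitor with a product density the same number.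
\<close>
lemma permuton_density_margin_integral:
  fixes \<phi> :: "real \<Rightarrow> real"
  assumes h: "permuton_density h g" and \<phi> [measurable]: "\<phi> \<in> borel_measurable borel"
    and bound: "\<And>s. s \<in> {0..1} \<Longrightarrow> \<bar>\<phi> s\<bar> \<le> K"
  shows "integrable square_lborel (\<lambda>z. g z * \<phi> (fst z))"
    and "(LINT z|square_lborel. g z * \<phi> (fst z)) = (LINT s|uniform_measure lborel {0..1}. \<phi> s)"
    and "integrable square_lborel (\<lambda>z. g z * \<phi> (snd z))"
    and "(LINT z|square_lborel. g z * \<phi> (snd z)) = (LINT s|uniform_measure lborel {0..1}. \<phi> s)"
proof -
  note g [measurable] = permuton_densityD[OF h]
  define M where "M = density square_lborel (\<lambda>z. ennreal (g z))"
  have M: "permuton M" unfolding M_def by (rule permuton_of_imp_permuton[OF g(3)])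
  interpret prob_space M by (rule prob_space_permuton[OF M])
  have ms [measurable]: "fst \<in> borel_measurable square_lborel" "snd \<in> borel_measurable square_lborel"
    by (simp_all add: borel_measurable_square_lborel)
  have mM [measurable]: "fst \<in> borel_measurable M" "snd \<in> borel_measurable M"
    by (simp_all add: measurable_cong_sets[OF sets_permuton[OF M] refl])
  have "AE z in M. norm (\<phi> (fst z)) \<le> K" "AE z in M. norm (\<phi> (snd z)) \<le> K"
    by (auto intro!: AE_I2 bound simp: space_permuton[OF M] unit_square_def)
  then have int: "integrable M (\<lambda>z. \<phi> (fst z))" "integrable M (\<lambda>z. \<phi> (snd z))"
    by (auto intro!: integrable_const_bound)
  then show "integrable square_lborel (\<lambda>z. g z * \<phi> (fst z))" "integrable square_lborel (\<lambda>z. g z * \<phi> (snd z))"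
    unfolding M_def using g(1,4) by (auto simp: integrable_density)
  have "(LINT s|distr M borel fst. \<phi> s) = (LINT z|M. \<phi> (fst z))"
    by (rule integral_distr) auto
  also have "\<dots> = (LINT z|square_lborel. g z * \<phi> (fst z))"
    unfolding M_def using g(1,4) by (subst integral_density) auto
  finally show "(LINT z|square_lborel. g z * \<phi> (fst z)) = (LINT s|uniform_measure lborel {0..1}. \<phi> s)"
    using M by (simp add: permuton_def)
  have "(LINT s|distr M borel snd. \<phi> s) = (LINT z|M. \<phi> (snd z))"
    by (rule integral_distr) auto
  also have "\<dots> = (LINT z|square_lborel. g z * \<phi> (snd z))"
    unfolding M_def using g(1,4) by (subst integral_density) auto
  finally show "(LINT z|square_lborel. g z * \<phi> (snd z)) = (LINT s|uniform_measure lborel {0..1}. \<phi> s)"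
    using M by (simp add: permuton_def)
qed

lemma permuton_density_unique:
  assumes "permuton_density h g" "permuton_density h g'"
  shows "AE z in square_lborel. g z = g' z"
proof -
  note g [measurable] = permuton_densityD[OF assms(1)]
  note g' [measurable] = permuton_densityD[OF assms(2)]
  interpret sigma_finite_measure square_lborel
    by (rule sigma_finite_measure_restrict_space[OF lborel.sigma_finite_measure_axioms]) simp
  have "AE z in square_lborel. ennreal (g z) = ennreal (g' z)"
    by (rule density_unique) (use permuton_of_unique[OF g(3) g'(3)] in auto)
  then show ?thesis using g(4) g'(4) by eventually_elim simp
qed

text \<open>
  The height function determines the permuton and hence the density almost everywhere, so the
  chosen density may be replaced by any other.
\<close>
lemma permuton_energy_eq:
  assumes h: "permuton_density h g"
  shows "permuton_energy h = (if integrable square_lborel (\<lambda>z. g z * ln (g z))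
    then ereal (- (LINT z|square_lborel. g z * ln (g z))) else -\<infinity>)"
proof -
  define g' where "g' = (SOME g. permuton_density h g)"
  have h': "permuton_density h g'" unfolding g'_def by (rule someI[of _ g]) (rule h)
  note [measurable] = permuton_densityD(1)[OF h] permuton_densityD(1)[OF h']
  have ae: "AE z in square_lborel. g' z * ln (g' z) = g z * ln (g z)"
    using permuton_density_unique[OF h h'] by eventually_elim simp
  have "integrable square_lborel (\<lambda>z. g' z * ln (g' z)) \<longleftrightarrow> integrable square_lborel (\<lambda>z. g z * ln (g z))"
    using ae by (intro integrable_cong_AE) auto
  moreover have "(LINT z|square_lborel. g' z * ln (g' z)) = (LINT z|square_lborel. g z * ln (g z))"
    using ae by (intro integral_cong_AE) auto
  ultimately show ?thesis using h by (auto simp: permuton_energy_def Let_def g'_def[symmetric])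
qed

context
  fixes hq :: "real \<times> real \<Rightarrow> real" and q and \<phi> \<psi> :: "real \<Rightarrow> real" and K :: real
  assumes q: "permuton_density hq q"
    and meas: "\<phi> \<in> borel_measurable borel" "\<psi> \<in> borel_measurable borel"
    and bound: "\<And>s. s \<in> {0..1} \<Longrightarrow> \<bar>\<phi> s\<bar> \<le> K" "\<And>t. t \<in> {0..1} \<Longrightarrow> \<bar>\<psi> t\<bar> \<le> K"
    and product: "\<And>z. z \<in> unit_square \<Longrightarrow> q z \<noteq> 0 \<Longrightarrow> q z = exp (\<phi> (fst z) + \<psi> (snd z))"
begin

private lemma cross_entropy:
  assumes h: "permuton_density h g"
  shows "integrable square_lborel (\<lambda>z. g z * (\<phi> (fst z) + \<psi> (snd z)))"
    and "(LINT z|square_lborel. g z * (\<phi> (fst z) + \<psi> (snd z))) =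
      (LINT s|uniform_measure lborel {0..1}. \<phi> s) + (LINT t|uniform_measure lborel {0..1}. \<psi> t)"
  using permuton_density_margin_integral[OF h meas(1) bound(1)]
    permuton_density_margin_integral[OF h meas(2) bound(2)]
  by (simp_all add: distrib_left)

lemma product_form_energy:
  "permuton_energy hq = ereal (- ((LINT s|uniform_measure lborel {0..1}. \<phi> s) + (LINT t|uniform_measure lborel {0..1}. \<psi> t)))"
proof -
  have eq: "q z * ln (q z) = q z * (\<phi> (fst z) + \<psi> (snd z))" if "z \<in> space square_lborel" for z
    using product[of z] that by (cases "q z = 0") (auto simp: space_square_lborel)
  have "integrable square_lborel (\<lambda>z. q z * ln (q z))"
    by (rule iffD2[OF Bochner_Integration.integrable_cong[OF refl eq] cross_entropy(1)[OF q]])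
  moreover have "(LINT z|square_lborel. q z * ln (q z)) = (LINT s|uniform_measure lborel {0..1}. \<phi> s) + (LINT t|uniform_measure lborel {0..1}. \<psi> t)"
    by (rule trans[OF Bochner_Integration.integral_cong[OF refl eq] cross_entropy(2)[OF q]])
  ultimately show ?thesis by (simp add: permuton_energy_eq[OF q])
qed

text \<open>
  The function \<open>F\<close> below is the pointwise relative entropy of \<open>g\<close> with respect to \<open>q\<close>. It is
  nonnegative and its integral is the energy of \<open>q\<close> minus that of \<open>g\<close>, since both densities
  have total mass one. If the competitor is at least as good, the integral is zero and
  so is \<open>F\<close>, which forces \<open>g = q\<close>.
\<close>
lemma product_form_unique_maximizer:
  assumes supp: "\<And>g. permuton_density h g \<Longrightarrow> AE z in square_lborel. q z = 0 \<longrightarrow> g z = 0"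
    and ge: "permuton_energy hq \<le> permuton_energy h"
  shows "permuton_density h q"
proof -
  define C where "C = (LINT s|uniform_measure lborel {0..1}. \<phi> s) + (LINT t|uniform_measure lborel {0..1}. \<psi> t)"
  have E: "ereal (- C) \<le> permuton_energy h" using ge by (simp add: product_form_energy C_def)
  then obtain g where h: "permuton_density h g"
    by (auto simp: permuton_energy_def split: if_splits)
  have int: "integrable square_lborel (\<lambda>z. g z * ln (g z))"
    and le: "(LINT z|square_lborel. g z * ln (g z)) \<le> C"
    using E permuton_energy_eq[OF h] by (auto split: if_splits)
  note ig = permuton_density_integral_one[OF h] and iq = permuton_density_integral_one[OF q]
    and ce = cross_entropy[OF h, folded C_def]
  define F where "F = (\<lambda>z. g z * ln (g z) - g z * (\<phi> (fst z) + \<psi> (snd z)) - g z + q z)"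
  have iF: "integrable square_lborel F" unfolding F_def
    using int ce ig iq by (intro Bochner_Integration.integrable_add Bochner_Integration.integrable_diff) auto
  have "(LINT z|square_lborel. F z) = (LINT z|square_lborel. g z * ln (g z)) - C"
    unfolding F_def using int ce ig iq by simp
  with le have "(LINT z|square_lborel. F z) \<le> 0" by simp
  have pt: "AE z in square_lborel. 0 \<le> F z \<and> (F z = 0 \<longrightarrow> g z = q z)"
    using supp[OF h] AE_space
  proof eventually_elim
    case (elim z)
    then have z: "z \<in> unit_square" by (simp add: space_square_lborel)
    show ?case
    proof (cases "q z = 0")
      case True
      then show ?thesis using elim by (simp add: F_def)
    next
      case False
      then have qz: "q z = exp (\<phi> (fst z) + \<psi> (snd z))" using product z by blast
      then have "F z = g z * ln (g z) - g z * ln (q z) - g z + q z" by (simp add: F_def)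
      with gibbs_pointwise[of "g z" "q z"] permuton_densityD(2)[OF h z] show ?thesis
        by (simp add: qz)
    qed
  qed
  then have nn: "AE z in square_lborel. 0 \<le> F z" by eventually_elim simp
  with \<open>(LINT z|square_lborel. F z) \<le> 0\<close> have "(LINT z|square_lborel. F z) = 0"
    using integral_nonneg_AE[OF nn] by simp
  then have "AE z in square_lborel. F z = 0"
    using integral_nonneg_eq_0_iff_AE[OF iF nn] by simp
  with pt have ae: "AE z in square_lborel. g z = q z" by eventually_elim simp
  have "density square_lborel (\<lambda>z. ennreal (g z)) = density square_lborel (\<lambda>z. ennreal (q z))"
    using permuton_densityD(1)[OF h] permuton_densityD(1)[OF q] ae by (intro density_cong) auto
  with h q show ?thesis by (simp add: permuton_density_def)
qed

end

lemma permuton_of_height_unique: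
  assumes "permuton_of h M" "permuton_of h' M" "h \<in> extensional unit_square" "h' \<in> extensional unit_square"
  shows "h = h'"
proof (rule extensionalityI)
  fix z :: "real \<times> real" assume "z \<in> unit_square"
  then have "fst z \<in> {0..1}" "snd z \<in> {0..1}" by (auto simp: unit_square_def)
  then show "h z = h' z" using height_eq[OF assms(1)] height_eq[OF assms(2)] by (metis prod.collapse)
qed (use assms in auto)

section \<open>Step permutons\<close>

text \<open>
  The index of the cell \<open>{x (u - 1)<..x u}\<close> that contains \<open>s\<close>. On a mesh, the point \<open>0\<close>
  lies in no such cell and gets index \<open>0\<close>.
\<close>
definition mesh_index :: "(nat \<Rightarrow> real) \<Rightarrow> real \<Rightarrow> nat" where
  "mesh_index x s = (LEAST u. s \<le> x u)"

lemma mesh_index_measurable [measurable]: "mesh_index x \<in> measurable borel (count_space UNIV)"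
  unfolding mesh_index_def by measurable

context
  fixes k x assumes mesh: "mesh k x"
begin

lemma mesh_strict: "i < j \<Longrightarrow> j \<le> k \<Longrightarrow> x i < x j"
  using mesh by (auto simp: mesh_def strict_mono_on_def)

lemma mesh_mono: "i \<le> j \<Longrightarrow> j \<le> k \<Longrightarrow> x i \<le> x j"
  using mesh_strict[of i j] by (cases "i = j") auto

lemma mesh_ends: "x 0 = 0" "x k = 1" "1 \<le> k"
  using mesh by (auto simp: mesh_def)

lemma mesh_bounds: "u \<le> k \<Longrightarrow> 0 \<le> x u" "u \<le> k \<Longrightarrow> x u \<le> 1"
  using mesh_mono[of 0 u] mesh_mono[of u k] mesh_ends by auto

lemma mesh_width_pos: "u \<in> {1..k} \<Longrightarrow> 0 < x u - x (u - 1)"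
  using mesh_strict[of "u - 1" u] by auto

lemma mesh_cell_subset: "u \<in> {1..k} \<Longrightarrow> {x (u - 1)<..x u} \<subseteq> {0..1}"
  using mesh_bounds[of "u - 1"] mesh_bounds[of u] by force

lemma mesh_index_cell:
  assumes "u \<in> {1..k}" "s \<in> {x (u - 1)<..x u}"
  shows "mesh_index x s = u"
  unfolding mesh_index_def
proof (rule Least_equality)
  fix i assume "s \<le> x i"
  show "u \<le> i"
  proof (rule ccontr)
    assume "\<not> u \<le> i"
    then have "x i \<le> x (u - 1)" using assms by (intro mesh_mono) auto
    with \<open>s \<le> x i\<close> assms show False by simp
  qed
qed (use assms in auto)

lemma mesh_index_le: "s \<in> {0..1} \<Longrightarrow> mesh_index x s \<le> k"
  unfolding mesh_index_def using mesh_ends by (intro Least_le) auto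

lemma mesh_index_in_cell:
  assumes "s \<in> {0<..1}"
  shows "mesh_index x s \<in> {1..k}" "s \<in> {x (mesh_index x s - 1)<..x (mesh_index x s)}"
proof -
  have le: "s \<le> x (mesh_index x s)"
    unfolding mesh_index_def by (rule LeastI[of _ k]) (use assms mesh_ends in auto)
  have "mesh_index x s \<noteq> 0" using le assms mesh_ends by (metis greaterThanAtMost_iff not_le)
  then show "mesh_index x s \<in> {1..k}" using mesh_index_le[of s] assms by auto
  have "\<not> s \<le> x (mesh_index x s - 1)"
    using not_less_Least[of "mesh_index x s - 1" "\<lambda>u. s \<le> x u"] \<open>mesh_index x s \<noteq> 0\<close>
    by (simp add: mesh_index_def)
  with le show "s \<in> {x (mesh_index x s - 1)<..x (mesh_index x s)}" by simp
qed

text \<open>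
  Up to the null set \<open>{0}\<close>, the cells partition \<open>{0..1}\<close>.
\<close>
lemma nn_integral_mesh_index:
  assumes f: "\<And>u. u \<in> {1..k} \<Longrightarrow> 0 \<le> f u"
  shows "(\<integral>\<^sup>+ s. ennreal (f (mesh_index x s)) * indicator {0..1} s \<partial>lborel)
    = ennreal (\<Sum>u=1..k. f u * (x u - x (u - 1)))"
proof -
  have "(\<integral>\<^sup>+ s. ennreal (f (mesh_index x s)) * indicator {0..1} s \<partial>lborel)
      = (\<integral>\<^sup>+ s. (\<Sum>u=1..k. ennreal (f u) * indicator {x (u - 1)<..x u} s) \<partial>lborel)"
  proof (rule nn_integral_cong_AE)
    have "AE s in lborel. s \<noteq> (0 :: real)" by (rule AE_lborel_singleton)
    then show "AE s in lborel. ennreal (f (mesh_index x s)) * indicator {0..1} s =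
        (\<Sum>u=1..k. ennreal (f u) * indicator {x (u - 1)<..x u} s)"
    proof eventually_elim
      case (elim s)
      show ?case
      proof (cases "s \<in> {0..1}")
        case True
        with elim have s: "s \<in> {0<..1}" by auto
        have "(\<Sum>u=1..k. ennreal (f u) * indicator {x (u - 1)<..x u} s)
            = (\<Sum>u=1..k. if u = mesh_index x s then ennreal (f u) else 0)"
        proof (rule sum.cong)
          fix u assume "u \<in> {1..k}"
          then have "s \<in> {x (u - 1)<..x u} \<longleftrightarrow> u = mesh_index x s"
            using mesh_index_in_cell(2)[OF s] mesh_index_cell by metis
          then show "ennreal (f u) * indicator {x (u - 1)<..x u} s = (if u = mesh_index x s then ennreal (f u) else 0)"
            by (simp add: indicator_def del: greaterThanAtMost_iff)
        qed simp
        also have "\<dots> = ennreal (f (mesh_index x s))"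
          using mesh_index_in_cell(1)[OF s] by (subst sum.delta) auto
        finally show ?thesis using True by simp
      next
        case False
        then have "s \<notin> {x (u - 1)<..x u}" if "u \<in> {1..k}" for u using mesh_cell_subset[OF that] by blast
        then have "(\<Sum>u=1..k. ennreal (f u) * indicator {x (u - 1)<..x u} s) = 0"
          by (intro sum.neutral) auto
        with False show ?thesis by simp
      qed
    qed
  qed
  also have "\<dots> = (\<Sum>u=1..k. ennreal (f u * (x u - x (u - 1))))"
    using f mesh_width_pos
    by (subst nn_integral_sum) (auto intro!: sum.cong simp: nn_integral_cmult ennreal_mult less_imp_le)
  also have "\<dots> = ennreal (\<Sum>u=1..k. f u * (x u - x (u - 1)))"
    using f mesh_width_pos by (intro sum_ennreal) (force intro!: mult_nonneg_nonneg)
  finally show ?thesis .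
qed

end

text \<open>
  By Tonelli's theorem, the mass that the density gives to a vertical or horizontal strip is the
  integral of the line integrals over its base.
\<close>
lemma permuton_density_squareI:
  assumes q [measurable]: "q \<in> borel_measurable borel" and nn: "\<And>z. z \<in> unit_square \<Longrightarrow> 0 \<le> q z"
    and fst: "AE s in lborel. s \<in> {0..1} \<longrightarrow> (\<integral>\<^sup>+ t. ennreal (q (s, t)) * indicator {0..1} t \<partial>lborel) = 1"
    and snd: "AE t in lborel. t \<in> {0..1} \<longrightarrow> (\<integral>\<^sup>+ s. ennreal (q (s, t)) * indicator {0..1} s \<partial>lborel) = 1"
  shows "permuton (density square_lborel (\<lambda>z. ennreal (q z)))"
proof -
  define M where "M = density square_lborel (\<lambda>z. ennreal (q z))"
  have sp: "space M = unit_square" and st: "sets M = sets (restrict_space borel unit_square)"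
    by (simp_all add: M_def space_square_lborel sets_square_lborel)
  have [measurable]: "q \<in> borel_measurable square_lborel"
    by (auto intro: measurable_restrict_space1 simp: measurable_lborel2)
  have [measurable]: "q \<in> borel_measurable (borel \<Otimes>\<^sub>M borel)" by (simp add: borel_prod)
  have [measurable]: "fst \<in> borel_measurable M" "snd \<in> borel_measurable M"
    by (simp_all add: measurable_cong_sets[OF st refl])
  have em: "emeasure M ((A \<times> B) \<inter> unit_square) =
      (\<integral>\<^sup>+ z. (ennreal (q z) * (indicator (A \<inter> {0..1}) (fst z) * indicator (B \<inter> {0..1}) (snd z))) \<partial>(lborel \<Otimes>\<^sub>M lborel))"
    if [measurable]: "A \<in> sets borel" "B \<in> sets borel" for A B
  proof -
    have eq: "(A \<times> B) \<inter> unit_square = (A \<inter> {0..1}) \<times> (B \<inter> {0..1})" by (auto simp: unit_square_def)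
    have "(A \<times> B) \<inter> unit_square \<in> sets square_lborel"
      unfolding eq sets_square_lborel using that by (intro Times_in_sets_square) auto
    then have "emeasure M ((A \<times> B) \<inter> unit_square) =
        (\<integral>\<^sup>+ z. ennreal (q z) * indicator ((A \<times> B) \<inter> unit_square) z \<partial>square_lborel)"
      unfolding M_def by (subst emeasure_density) auto
    also have "\<dots> = (\<integral>\<^sup>+ z. (ennreal (q z) * indicator ((A \<times> B) \<inter> unit_square) z) * indicator unit_square z \<partial>lborel)"
      by (subst nn_integral_restrict_space) auto
    also have "\<dots> = (\<integral>\<^sup>+ z. (ennreal (q z) * (indicator (A \<inter> {0..1}) (fst z) * indicator (B \<inter> {0..1}) (snd z))) \<partial>lborel)"
      by (intro nn_integral_cong) (auto simp: unit_square_def indicator_def)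
    finally show ?thesis by (simp add: lborel_prod)
  qed
  have distr_fst: "emeasure (distr M borel fst) A = emeasure (uniform_measure lborel {0..1}) A" if A [measurable]: "A \<in> sets borel" for A
  proof -
    have "emeasure (distr M borel fst) A = emeasure M ((A \<times> UNIV) \<inter> unit_square)"
      by (subst emeasure_distr) (auto simp: sp intro!: arg_cong[of _ _ "emeasure M"])
    also have "\<dots> = (\<integral>\<^sup>+ s. \<integral>\<^sup>+ t. ennreal (q (s, t)) * (indicator (A \<inter> {0..1}) s * indicator {0..1} t) \<partial>lborel \<partial>lborel)"
      by (subst em) (simp_all add: lborel.nn_integral_fst[symmetric])
    also have "\<dots> = (\<integral>\<^sup>+ s. indicator (A \<inter> {0..1}) s * (\<integral>\<^sup>+ t. ennreal (q (s, t)) * indicator {0..1} t \<partial>lborel) \<partial>lborel)"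
      by (intro nn_integral_cong, subst nn_integral_cmult[symmetric]) (auto simp: ac_simps)
    also have "\<dots> = (\<integral>\<^sup>+ s. indicator (A \<inter> {0..1}) s \<partial>lborel)"
      by (rule nn_integral_cong_AE) (use fst in \<open>eventually_elim, auto simp: indicator_def\<close>)
    also have "\<dots> = emeasure lborel (A \<inter> {0..1})" by simp
    finally show ?thesis by (simp add: Int_commute divide_ennreal_def)
  qed
  have distr_snd: "emeasure (distr M borel snd) A = emeasure (uniform_measure lborel {0..1}) A" if A [measurable]: "A \<in> sets borel" for A
  proof -
    have "emeasure (distr M borel snd) A = emeasure M ((UNIV \<times> A) \<inter> unit_square)"
      by (subst emeasure_distr) (auto simp: sp intro!: arg_cong[of _ _ "emeasure M"])
    also have "\<dots> = (\<integral>\<^sup>+ t. \<integral>\<^sup>+ s. ennreal (q (s, t)) * (indicator {0..1} s * indicator (A \<inter> {0..1}) t) \<partial>lborel \<partial>lborel)"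
      by (subst em) (simp_all add: lborel_pair.nn_integral_snd[symmetric])
    also have "\<dots> = (\<integral>\<^sup>+ t. indicator (A \<inter> {0..1}) t * (\<integral>\<^sup>+ s. ennreal (q (s, t)) * indicator {0..1} s \<partial>lborel) \<partial>lborel)"
      by (intro nn_integral_cong, subst nn_integral_cmult[symmetric]) (auto simp: ac_simps)
    also have "\<dots> = (\<integral>\<^sup>+ t. indicator (A \<inter> {0..1}) t \<partial>lborel)"
      by (rule nn_integral_cong_AE) (use snd in \<open>eventually_elim, auto simp: indicator_def\<close>)
    also have "\<dots> = emeasure lborel (A \<inter> {0..1})" by simp
    finally show ?thesis by (simp add: Int_commute divide_ennreal_def)
  qed
  have "emeasure (distr M borel fst) UNIV = 1" by (subst distr_fst) (auto simp: divide_ennreal_def)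
  then have "emeasure M (space M) = 1" by (subst (asm) emeasure_distr) auto
  then have "prob_space M" by (rule prob_spaceI)
  moreover have "distr M borel fst = uniform_measure lborel {0..1}" by (rule measure_eqI) (auto simp: distr_fst)
  moreover have "distr M borel snd = uniform_measure lborel {0..1}" by (rule measure_eqI) (auto simp: distr_snd)
  ultimately show ?thesis unfolding permuton_def using st by (simp add: M_def)
qed

lemma step_permuton:
  assumes x: "mesh k x" and y: "mesh l y" and nn: "\<And>u v. 0 \<le> f u v"
    and row: "\<And>u. u \<in> {1..k} \<Longrightarrow> (\<Sum>v=1..l. f u v * (y v - y (v - 1))) = 1"
    and col: "\<And>v. v \<in> {1..l} \<Longrightarrow> (\<Sum>u=1..k. f u v * (x u - x (u - 1))) = 1"
  shows "\<exists>h. h \<in> extensional unit_square \<and>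
    permuton_density h (\<lambda>z. f (mesh_index x (fst z)) (mesh_index y (snd z)))"
proof -
  define q where "q = (\<lambda>z. f (mesh_index x (fst z)) (mesh_index y (snd z)))"
  have [measurable]: "(\<lambda>z. mesh_index x (fst z)) \<in> measurable (borel :: (real \<times> real) measure) (count_space UNIV)"
    "(\<lambda>z. mesh_index y (snd z)) \<in> measurable (borel :: (real \<times> real) measure) (count_space UNIV)"
    by (auto intro!: measurable_compose[OF _ mesh_index_measurable] borel_measurable_continuous_onI continuous_intros)
  have q: "q \<in> borel_measurable borel" unfolding q_def
    by (rule measurable_compose_countable, rule measurable_compose_countable) auto
  have nz: "AE s in lborel. s \<noteq> (0 :: real)" by (rule AE_lborel_singleton)
  define M where "M = density square_lborel (\<lambda>z. ennreal (q z))"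
  have "permuton M" unfolding M_def
  proof (rule permuton_density_squareI[OF q])
    show "0 \<le> q z" for z by (simp add: q_def nn)
    show "AE s in lborel. s \<in> {0..1} \<longrightarrow> (\<integral>\<^sup>+ t. ennreal (q (s, t)) * indicator {0..1} t \<partial>lborel) = 1"
      using nz
    proof (eventually_elim, intro impI)
      fix s :: real assume "s \<noteq> 0" "s \<in> {0..1}"
      then have "mesh_index x s \<in> {1..k}" by (intro mesh_index_in_cell(1)[OF x]) auto
      then show "(\<integral>\<^sup>+ t. ennreal (q (s, t)) * indicator {0..1} t \<partial>lborel) = 1"
        using nn_integral_mesh_index[OF y, of "f (mesh_index x s)"] row by (simp add: q_def nn)
    qed
    show "AE t in lborel. t \<in> {0..1} \<longrightarrow> (\<integral>\<^sup>+ s. ennreal (q (s, t)) * indicator {0..1} s \<partial>lborel) = 1"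
      using nz
    proof (eventually_elim, intro impI)
      fix t :: real assume "t \<noteq> 0" "t \<in> {0..1}"
      then have "mesh_index y t \<in> {1..l}" by (intro mesh_index_in_cell(1)[OF y]) auto
      then show "(\<integral>\<^sup>+ s. ennreal (q (s, t)) * indicator {0..1} s \<partial>lborel) = 1"
        using nn_integral_mesh_index[OF x, of "\<lambda>u. f u (mesh_index y t)"] col by (simp add: q_def nn)
    qed
  qed
  define h where "h = restrict (\<lambda>(s, t). measure M ({s..1} \<times> {0..t})) unit_square"
  have "permuton_of h M" using \<open>permuton M\<close> by (auto simp: permuton_of_def h_def unit_square_def)
  then have "permuton_density h q"
    using q by (auto simp: permuton_density_def M_def q_def nn intro: measurable_restrict_space1)
  then show ?thesis unfolding q_def by (intro exI[of _ h]) (auto simp: h_def)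
qed

text \<open>
  The constraint on a cell says that the permuton gives it no mass.
\<close>
lemma height_functions_on_iff_density:
  assumes x: "mesh k x" and y: "mesh l y" and ext: "h \<in> extensional unit_square"
    and h: "permuton_density h g"
  shows "h \<in> height_functions_on k l x y I \<longleftrightarrow>
    (\<forall>u\<in>{1..k}. \<forall>v\<in>{1..l}. I u v = 0 \<longrightarrow>
      (AE z in square_lborel. z \<in> {x (u - 1)<..x u} \<times> {y (v - 1)<..y v} \<longrightarrow> g z = 0))"
proof -
  note g = permuton_densityD[OF h]
  define M where "M = density square_lborel (\<lambda>z. ennreal (g z))"
  have hM: "permuton_of h M" using g(3) by (simp add: M_def)
  interpret prob_space M by (rule prob_space_permuton[OF permuton_of_imp_permuton[OF hM]])
  have "h (x u, y v) + h (x (u - 1), y (v - 1)) - h (x u, y (v - 1)) - h (x (u - 1), y v) = 0 \<longleftrightarrow>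
      (AE z in square_lborel. z \<in> {x (u - 1)<..x u} \<times> {y (v - 1)<..y v} \<longrightarrow> g z = 0)"
    if uv: "u \<in> {1..k}" "v \<in> {1..l}" for u v
  proof -
    define A where "A = {x (u - 1)<..x u} \<times> {y (v - 1)<..y v}"
    have "A \<in> sets square_lborel" unfolding A_def sets_square_lborel
      using mesh_cell_subset[OF x uv(1)] mesh_cell_subset[OF y uv(2)] by (intro Times_in_sets_square) auto
    then have AM: "A \<in> sets M" by (simp add: M_def)
    have "h (x u, y v) + h (x (u - 1), y (v - 1)) - h (x u, y (v - 1)) - h (x (u - 1), y v) = - measure M A"
      unfolding A_def
      using uv mesh_bounds[OF x] mesh_bounds[OF y] mesh_mono[OF x, of "u - 1" u] mesh_mono[OF y, of "v - 1" v]
      by (intro height_rect[OF hM]) auto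
    then have "h (x u, y v) + h (x (u - 1), y (v - 1)) - h (x u, y (v - 1)) - h (x (u - 1), y v) = 0 \<longleftrightarrow> A \<in> null_sets M"
      using AM by (auto simp: null_sets_def emeasure_eq_measure)
    also have "\<dots> \<longleftrightarrow> (AE z in square_lborel. z \<in> A \<longrightarrow> ennreal (g z) = 0)"
      unfolding M_def using g(1) \<open>A \<in> sets square_lborel\<close> by (subst null_sets_density_iff) auto
    also have "\<dots> \<longleftrightarrow> (AE z in square_lborel. z \<in> A \<longrightarrow> g z = 0)"
    proof
      assume "AE z in square_lborel. z \<in> A \<longrightarrow> ennreal (g z) = 0"
      then show "AE z in square_lborel. z \<in> A \<longrightarrow> g z = 0"
        using g(4) by eventually_elim (auto simp: ennreal_eq_0_iff)
    next
      assume "AE z in square_lborel. z \<in> A \<longrightarrow> g z = 0"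
      then show "AE z in square_lborel. z \<in> A \<longrightarrow> ennreal (g z) = 0"
        by eventually_elim simp
    qed
    finally show ?thesis by (simp add: A_def)
  qed
  moreover have "h \<in> height_functions" by (rule permuton_of_in_height_functions[OF hM ext])
  ultimately show ?thesis by (simp add: height_functions_on_def)
qed

text \<open>
  A product-form matrix gives a product-form density, with \<open>\<phi> = \<alpha> \<circ> mesh_index x\<close> and
  \<open>\<psi> = \<beta> \<circ> mesh_index y\<close>. The matrix vanishes only at grid indices:
  at the index \<open>0\<close>, which is taken on two edges of the square, it
  is positive, so that the density vanishes on the forbidden cells and nowhere else.
\<close>
lemma product_step_unique_maximizer:
  assumes x: "mesh k x" and y: "mesh l y"
    and f: "\<And>u v. f u v = (if u \<in> {1..k} \<and> v \<in> {1..l} \<and> I u v = 0 then 0 else exp (\<alpha> u + \<beta> v))"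
    and row: "\<And>u. u \<in> {1..k} \<Longrightarrow> (\<Sum>v=1..l. f u v * (y v - y (v - 1))) = 1"
    and col: "\<And>v. v \<in> {1..l} \<Longrightarrow> (\<Sum>u=1..k. f u v * (x u - x (u - 1))) = 1"
  shows "\<exists>h. permuton_density h (\<lambda>z. f (mesh_index x (fst z)) (mesh_index y (snd z))) \<and>
    (\<forall>h'. is_arg_max permuton_energy (\<lambda>h. h \<in> height_functions_on k l x y I) h' \<longleftrightarrow> h' = h)"
proof -
  define q where "q = (\<lambda>z. f (mesh_index x (fst z)) (mesh_index y (snd z)))"
  have nn: "0 \<le> f u v" for u v by (simp add: f)
  obtain h where ext: "h \<in> extensional unit_square" and h: "permuton_density h q"
    unfolding q_def using step_permuton[OF x y nn row col] by blast
  define K where "K = (\<Sum>u\<le>k. \<bar>\<alpha> u\<bar>) + (\<Sum>v\<le>l. \<bar>\<beta> v\<bar>)"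
  have K: "\<bar>\<alpha> u\<bar> \<le> K" "\<bar>\<beta> v\<bar> \<le> K" if "u \<le> k" "v \<le> l" for u v
  proof -
    have "\<bar>\<alpha> u\<bar> \<le> (\<Sum>u\<le>k. \<bar>\<alpha> u\<bar>)" "\<bar>\<beta> v\<bar> \<le> (\<Sum>v\<le>l. \<bar>\<beta> v\<bar>)"
      using that by (auto intro!: member_le_sum)
    moreover have "0 \<le> (\<Sum>u\<le>k. \<bar>\<alpha> u\<bar>)" "0 \<le> (\<Sum>v\<le>l. \<bar>\<beta> v\<bar>)" by (auto intro!: sum_nonneg)
    ultimately show "\<bar>\<alpha> u\<bar> \<le> K" "\<bar>\<beta> v\<bar> \<le> K" unfolding K_def by linarith+
  qed
  have mem: "h \<in> height_functions_on k l x y I"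
    unfolding height_functions_on_iff_density[OF x y ext h]
    by (auto intro!: AE_I2 simp: q_def f mesh_index_cell[OF x] mesh_index_cell[OF y])
  have max: "h' = h" if h': "h' \<in> height_functions_on k l x y I" and ge: "permuton_energy h \<le> permuton_energy h'" for h'
  proof -
    have ext': "h' \<in> extensional unit_square"
      using h' by (simp add: height_functions_on_def height_functions_def)
    have "permuton_density h' q"
    proof (rule product_form_unique_maximizer[OF h, of "\<lambda>s. \<alpha> (mesh_index x s)" "\<lambda>t. \<beta> (mesh_index y t)" K])
      show "(\<lambda>s. \<alpha> (mesh_index x s)) \<in> borel_measurable borel" "(\<lambda>t. \<beta> (mesh_index y t)) \<in> borel_measurable borel"
        by (auto intro: measurable_compose[OF mesh_index_measurable])
      show "\<bar>\<alpha> (mesh_index x s)\<bar> \<le> K" if "s \<in> {0..1}" for s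
        by (rule K(1)[OF mesh_index_le[OF x that] order_refl])
      show "\<bar>\<beta> (mesh_index y t)\<bar> \<le> K" if "t \<in> {0..1}" for t
        by (rule K(2)[OF order_refl mesh_index_le[OF y that]])
      show "q z = exp (\<alpha> (mesh_index x (fst z)) + \<beta> (mesh_index y (snd z)))" if "q z \<noteq> 0" for z
        using that by (auto simp: q_def f split: if_splits)
      show "permuton_energy h \<le> permuton_energy h'" by (rule ge)
      fix g assume g: "permuton_density h' g"
      have "AE z in square_lborel. \<forall>u\<in>{1..k}. \<forall>v\<in>{1..l}. I u v = 0 \<longrightarrow>
          z \<in> {x (u - 1)<..x u} \<times> {y (v - 1)<..y v} \<longrightarrow> g z = 0"
        using h'[unfolded height_functions_on_iff_density[OF x y ext' g]]
        by (intro AE_ball_countable[THEN iffD2] ballI) auto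
      then show "AE z in square_lborel. q z = 0 \<longrightarrow> g z = 0"
        using AE_space
      proof eventually_elim
        case (elim z)
        show ?case
        proof
          assume "q z = 0"
          define u v where "u = mesh_index x (fst z)" and "v = mesh_index y (snd z)"
          have uv: "u \<in> {1..k}" "v \<in> {1..l}" "I u v = 0"
            using \<open>q z = 0\<close> by (auto simp: q_def f u_def v_def split: if_splits)
          have z: "fst z \<in> {0..1}" "snd z \<in> {0..1}" using elim(2)[unfolded space_square_lborel] by (auto simp: unit_square_def)
          have "mesh_index x 0 = 0" "mesh_index y 0 = 0"
            unfolding mesh_index_def using mesh_ends[OF x] mesh_ends[OF y] by (auto intro!: Least_equality)
          then have "fst z \<noteq> 0" "snd z \<noteq> 0" using uv by (auto simp: u_def v_def)
          then have "fst z \<in> {0<..1}" "snd z \<in> {0<..1}" using z by auto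
          then have "fst z \<in> {x (u - 1)<..x u}" "snd z \<in> {y (v - 1)<..y v}"
            unfolding u_def v_def using mesh_index_in_cell(2)[OF x] mesh_index_in_cell(2)[OF y] by blast+
          then have "z \<in> {x (u - 1)<..x u} \<times> {y (v - 1)<..y v}" by (cases z) auto
          then show "g z = 0" using elim(1) uv by blast
        qed
      qed
    qed
    then show "h' = h"
      using permuton_of_height_unique[OF _ _ ext' ext] permuton_densityD(3)[OF h] permuton_densityD(3) by blast
  qed
  have "is_arg_max permuton_energy (\<lambda>h. h \<in> height_functions_on k l x y I) h' \<longleftrightarrow> h' = h" for h'
  proof
    assume "is_arg_max permuton_energy (\<lambda>h. h \<in> height_functions_on k l x y I) h'"
    then show "h' = h" using mem by (intro max) (auto simp: is_arg_max_def not_less)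
  next
    assume "h' = h"
    then show "is_arg_max permuton_energy (\<lambda>h. h \<in> height_functions_on k l x y I) h'"
      using mem max[OF _ less_imp_le] by (auto simp: is_arg_max_def)
  qed
  with h show ?thesis unfolding q_def by blast
qed

section \<open>The margin equations\<close>

lemma same_margins_grid:
  fixes F F' :: "nat \<Rightarrow> nat \<Rightarrow> real"
  assumes E: "E = {(u, v). u \<in> {1..k} \<and> v \<in> {1..l} \<and> I u v = (1 :: nat)}"
    and F: "\<And>u v. u \<in> {1..k} \<Longrightarrow> v \<in> {1..l} \<Longrightarrow> I u v \<noteq> 1 \<Longrightarrow> F u v = 0"
    and F': "\<And>u v. u \<in> {1..k} \<Longrightarrow> v \<in> {1..l} \<Longrightarrow> I u v \<noteq> 1 \<Longrightarrow> F' u v = 0"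
  shows "same_margins E (\<lambda>(u, v). F u v) (\<lambda>(u, v). F' u v) \<longleftrightarrow>
    (\<forall>u\<in>{1..k}. (\<Sum>v=1..l. F u v) = (\<Sum>v=1..l. F' u v)) \<and>
    (\<forall>v\<in>{1..l}. (\<Sum>u=1..k. F u v) = (\<Sum>u=1..k. F' u v))"
proof -
  have row: "(\<Sum>e\<in>{e\<in>E. fst e = u}. (\<lambda>(u, v). H u v) e) = (if u \<in> {1..k} then \<Sum>v=1..l. H u v else 0)"
    if H: "\<And>u v. u \<in> {1..k} \<Longrightarrow> v \<in> {1..l} \<Longrightarrow> I u v \<noteq> 1 \<Longrightarrow> H u v = 0" for H :: "nat \<Rightarrow> nat \<Rightarrow> real" and u
  proof (cases "u \<in> {1..k}")
    case True
    have "{e\<in>E. fst e = u} = Pair u ` {v\<in>{1..l}. I u v = 1}" using True by (auto simp: E)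
    then have "(\<Sum>e\<in>{e\<in>E. fst e = u}. (\<lambda>(u, v). H u v) e) = (\<Sum>v\<in>{v\<in>{1..l}. I u v = 1}. H u v)"
      by (simp add: sum.reindex inj_on_def)
    also have "\<dots> = (\<Sum>v=1..l. H u v)" by (rule sum.mono_neutral_left) (use H True in auto)
    finally show ?thesis using True by simp
  qed (auto simp: E intro!: sum.neutral)
  have col: "(\<Sum>e\<in>{e\<in>E. snd e = v}. (\<lambda>(u, v). H u v) e) = (if v \<in> {1..l} then \<Sum>u=1..k. H u v else 0)"
    if H: "\<And>u v. u \<in> {1..k} \<Longrightarrow> v \<in> {1..l} \<Longrightarrow> I u v \<noteq> 1 \<Longrightarrow> H u v = 0" for H :: "nat \<Rightarrow> nat \<Rightarrow> real" and v
  proof (cases "v \<in> {1..l}")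
    case True
    have "{e\<in>E. snd e = v} = (\<lambda>u. (u, v)) ` {u\<in>{1..k}. I u v = 1}" using True by (auto simp: E)
    then have "(\<Sum>e\<in>{e\<in>E. snd e = v}. (\<lambda>(u, v). H u v) e) = (\<Sum>u\<in>{u\<in>{1..k}. I u v = 1}. H u v)"
      by (simp add: sum.reindex inj_on_def)
    also have "\<dots> = (\<Sum>u=1..k. H u v)" by (rule sum.mono_neutral_left) (use H True in auto)
    finally show ?thesis using True by simp
  qed (auto simp: E intro!: sum.neutral)
  have "(\<Sum>e\<in>{e\<in>E. fst e = u}. (\<lambda>(u, v). F u v) e) = (if u \<in> {1..k} then \<Sum>v=1..l. F u v else 0)"
    "(\<Sum>e\<in>{e\<in>E. fst e = u}. (\<lambda>(u, v). F' u v) e) = (if u \<in> {1..k} then \<Sum>v=1..l. F' u v else 0)" for u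
    by (rule row, fact F, rule row, fact F')
  moreover have "(\<Sum>e\<in>{e\<in>E. snd e = v}. (\<lambda>(u, v). F u v) e) = (if v \<in> {1..l} then \<Sum>u=1..k. F u v else 0)"
    "(\<Sum>e\<in>{e\<in>E. snd e = v}. (\<lambda>(u, v). F' u v) e) = (if v \<in> {1..l} then \<Sum>u=1..k. F' u v else 0)" for v
    by (rule col, fact F, rule col, fact F')
  ultimately show ?thesis by (simp only: same_margins_def) auto
qed

text \<open>
  The matrix that witnesses non-degeneracy has the required support and margins; it is scaled.
\<close>
lemma margin_equations_solvable:
  assumes I: "\<forall>u\<in>{1..k}. \<forall>v\<in>{1..l}. I u v \<in> {0, 1}" and nd: "nondegenerate k l x y I"
  obtains lam mu where "\<And>u. 0 < lam u" "\<And>v. 0 < mu v" "margin_equations k l x y I lam mu"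
proof -
  define E where "E = {(u, v). u \<in> {1..k} \<and> v \<in> {1..l} \<and> I u v = 1}"
  have fin: "finite E" by (rule finite_subset[of _ "{1..k} \<times> {1..l}"]) (auto simp: E_def)
  obtain B :: "nat \<Rightarrow> nat \<Rightarrow> real" where
    B: "\<And>u v. u \<in> {1..k} \<Longrightarrow> v \<in> {1..l} \<Longrightarrow> 0 \<le> B u v \<and> (0 < B u v \<longleftrightarrow> I u v = 1)"
    and Br: "\<forall>u\<in>{1..k}. (\<Sum>v=1..l. B u v) = x u - x (u - 1)"
    and Bc: "\<forall>v\<in>{1..l}. (\<Sum>u=1..k. B u v) = y v - y (v - 1)"
    using nd unfolding nondegenerate_def by blast
  obtain lam mu where pos: "\<And>u. 0 < lam u" "\<And>v. 0 < mu v"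
    and same: "same_margins E (\<lambda>(u, v). lam u * mu v) (\<lambda>(u, v). B u v)"
  proof -
    have "\<exists>lam mu. (\<forall>u. 0 < lam u) \<and> (\<forall>v. 0 < mu v) \<and>
        same_margins E (\<lambda>(u, v). lam u * mu v) (\<lambda>(u, v). B u v)"
      by (rule matrix_scaling[OF fin]) (use B in \<open>auto simp: E_def\<close>)
    then show thesis using that by blast
  qed
  have "same_margins E (\<lambda>(u, v). real (I u v) * lam u * mu v) (\<lambda>(u, v). B u v)"
    using same by (subst same_margins_cong[of E _ "\<lambda>(u, v). lam u * mu v"]) (auto simp: E_def)
  then have "(\<forall>u\<in>{1..k}. (\<Sum>v=1..l. real (I u v) * lam u * mu v) = (\<Sum>v=1..l. B u v)) \<and>
      (\<forall>v\<in>{1..l}. (\<Sum>u=1..k. real (I u v) * lam u * mu v) = (\<Sum>u=1..k. B u v))"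
  proof (subst (asm) same_margins_grid[OF E_def])
    show "real (I u v) * lam u * mu v = 0" if "u \<in> {1..k}" "v \<in> {1..l}" "I u v \<noteq> 1" for u v
    proof -
      have "I u v = 0" using I that by blast
      then show ?thesis by simp
    qed
    show "B u v = 0" if "u \<in> {1..k}" "v \<in> {1..l}" "I u v \<noteq> 1" for u v
      using B[OF that(1,2)] that(3) by auto
  qed
  then have "margin_equations k l x y I lam mu"
    using Br Bc by (simp add: margin_equations_def)
  with pos show thesis by (rule that)
qed

lemma margin_equations_unique:
  assumes I: "\<forall>u\<in>{1..k}. \<forall>v\<in>{1..l}. I u v \<in> {0, 1}"
    and pos: "\<forall>u\<in>{1..k}. 0 < lam u" "\<forall>v\<in>{1..l}. 0 < mu v" "\<forall>u\<in>{1..k}. 0 < lam' u" "\<forall>v\<in>{1..l}. 0 < mu' v"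
    and eqs: "margin_equations k l x y I lam mu" "margin_equations k l x y I lam' mu'"
    and uv: "u \<in> {1..k}" "v \<in> {1..l}"
  shows "real (I u v) * lam u * mu v = real (I u v) * lam' u * mu' v"
proof (cases "I u v = 1")
  case True
  define E where "E = {(u, v). u \<in> {1..k} \<and> v \<in> {1..l} \<and> I u v = 1}"
  have fin: "finite E" by (rule finite_subset[of _ "{1..k} \<times> {1..l}"]) (auto simp: E_def)
  have "same_margins E (\<lambda>(u, v). real (I u v) * lam u * mu v) (\<lambda>(u, v). real (I u v) * lam' u * mu' v)"
  proof (subst same_margins_grid[OF E_def])
    show "real (I u v) * lam u * mu v = 0" "real (I u v) * lam' u * mu' v = 0"
      if "u \<in> {1..k}" "v \<in> {1..l}" "I u v \<noteq> 1" for u v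
    proof -
      have "I u v = 0" using I that by blast
      then show "real (I u v) * lam u * mu v = 0" "real (I u v) * lam' u * mu' v = 0" by simp_all
    qed
    have "(\<Sum>v=1..l. real (I u v) * lam u * mu v) = (\<Sum>v=1..l. real (I u v) * lam' u * mu' v)"
      if "u \<in> {1..k}" for u
      using bspec[OF conjunct1[OF eqs(1)[unfolded margin_equations_def]] that]
        bspec[OF conjunct1[OF eqs(2)[unfolded margin_equations_def]] that] by (rule trans[OF sym])
    moreover have "(\<Sum>u=1..k. real (I u v) * lam u * mu v) = (\<Sum>u=1..k. real (I u v) * lam' u * mu' v)"
      if "v \<in> {1..l}" for v
      using bspec[OF conjunct2[OF eqs(1)[unfolded margin_equations_def]] that]
        bspec[OF conjunct2[OF eqs(2)[unfolded margin_equations_def]] that] by (rule trans[OF sym])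
    ultimately show "(\<forall>u\<in>{1..k}. (\<Sum>v=1..l. real (I u v) * lam u * mu v) = (\<Sum>v=1..l. real (I u v) * lam' u * mu' v)) \<and>
      (\<forall>v\<in>{1..l}. (\<Sum>u=1..k. real (I u v) * lam u * mu v) = (\<Sum>u=1..k. real (I u v) * lam' u * mu' v))"
      by blast
  qed
  then have "same_margins E (\<lambda>(u, v). lam u * mu v) (\<lambda>(u, v). lam' u * mu' v)"
    by (subst (asm) same_margins_cong[of E _ "\<lambda>(u, v). lam u * mu v" _ "\<lambda>(u, v). lam' u * mu' v"]) (auto simp: E_def)
  then have "lam u * mu v = lam' u * mu' v"
    by (rule scaled_matrix_unique[OF fin, rotated]) (use pos uv True in \<open>auto simp: E_def\<close>)
  then show ?thesis by (simp add: mult.assoc)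
next
  case False
  with I uv have "I u v = 0" by blast
  then show ?thesis by simp
qed

theorem theorem4p12:
  fixes k l :: nat and x y :: "nat \<Rightarrow> real" and I :: "nat \<Rightarrow> nat \<Rightarrow> nat"
  assumes "mesh k x" and "mesh l y"
    and "\<forall>u\<in>{1..k}. \<forall>v\<in>{1..l}. I u v \<in> {0, 1}"
    and "nondegenerate k l x y I"
  shows "(\<exists>!h. is_arg_max permuton_energy (\<lambda>h. h \<in> height_functions_on k l x y I) h) \<and>
    (\<forall>h. is_arg_max permuton_energy (\<lambda>h. h \<in> height_functions_on k l x y I) h \<longrightarrow>
      (\<exists>g G. permuton_density h g \<and>
        (\<forall>u\<in>{1..k}. \<forall>v\<in>{1..l}. \<forall>s\<in>{x (u - 1)<..<x u}. \<forall>t\<in>{y (v - 1)<..<y v}.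
           g (s, t) = G u v / ((x u - x (u - 1)) * (y v - y (v - 1)))) \<and>
        (\<exists>lam mu. (\<forall>u\<in>{1..k}. 0 < lam u) \<and> (\<forall>v\<in>{1..l}. 0 < mu v) \<and>
           (\<forall>u\<in>{1..k}. \<forall>v\<in>{1..l}. G u v = real (I u v) * lam u * mu v) \<and>
           margin_equations k l x y I lam mu) \<and>
        (\<forall>lam mu. (\<forall>u\<in>{1..k}. 0 < lam u) \<and> (\<forall>v\<in>{1..l}. 0 < mu v) \<and>
           margin_equations k l x y I lam mu \<longrightarrow>
           (\<forall>u\<in>{1..k}. \<forall>v\<in>{1..l}. G u v = real (I u v) * lam u * mu v))))"
proof -
  note x = assms(1) and y = assms(2) and I = assms(3)
  obtain lam mu where pos: "\<And>u. 0 < lam u" "\<And>v. 0 < mu v" and eqs: "margin_equations k l x y I lam mu"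
    using margin_equations_solvable[OF I assms(4)] by blast
  define \<alpha> where "\<alpha> = (\<lambda>u. ln (lam u / (x u - x (u - 1))))"
  define \<beta> where "\<beta> = (\<lambda>v. ln (mu v / (y v - y (v - 1))))"
  \<comment> \<open>The cell widths are absorbed into the exponents, as a density divides the mass of a cell by its area.\<close>
  define f where "f = (\<lambda>u v. if u \<in> {1..k} \<and> v \<in> {1..l} \<and> I u v = 0 then 0 else exp (\<alpha> u + \<beta> v))"
  define G where "G = (\<lambda>u v. real (I u v) * lam u * mu v)"
  have f_eq: "f u v = G u v / ((x u - x (u - 1)) * (y v - y (v - 1)))" if "u \<in> {1..k}" "v \<in> {1..l}" for u v
  proof -
    have "exp (\<alpha> u) = lam u / (x u - x (u - 1))" "exp (\<beta> v) = mu v / (y v - y (v - 1))"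
      using mesh_width_pos[OF x that(1)] mesh_width_pos[OF y that(2)] pos by (auto simp: \<alpha>_def \<beta>_def)
    then show ?thesis using I that by (force simp: f_def G_def exp_add)
  qed
  have row: "(\<Sum>v=1..l. f u v * (y v - y (v - 1))) = 1" if u: "u \<in> {1..k}" for u
  proof -
    have "(\<Sum>v=1..l. f u v * (y v - y (v - 1))) = (\<Sum>v=1..l. G u v / (x u - x (u - 1)))"
    proof (rule sum.cong)
      fix v assume v: "v \<in> {1..l}"
      show "f u v * (y v - y (v - 1)) = G u v / (x u - x (u - 1))"
        using mesh_width_pos[OF y v] by (simp add: f_eq[OF u v])
    qed simp
    also have "\<dots> = (\<Sum>v=1..l. G u v) / (x u - x (u - 1))" by (simp add: sum_divide_distrib)
    also have "(\<Sum>v=1..l. G u v) = x u - x (u - 1)" using eqs u by (simp add: margin_equations_def G_def)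
    finally show ?thesis using mesh_width_pos[OF x u] by simp
  qed
  have col: "(\<Sum>u=1..k. f u v * (x u - x (u - 1))) = 1" if v: "v \<in> {1..l}" for v
  proof -
    have "(\<Sum>u=1..k. f u v * (x u - x (u - 1))) = (\<Sum>u=1..k. G u v / (y v - y (v - 1)))"
    proof (rule sum.cong)
      fix u assume u: "u \<in> {1..k}"
      show "f u v * (x u - x (u - 1)) = G u v / (y v - y (v - 1))"
        using mesh_width_pos[OF x u] by (simp add: f_eq[OF u v])
    qed simp
    also have "\<dots> = (\<Sum>u=1..k. G u v) / (y v - y (v - 1))" by (simp add: sum_divide_distrib)
    also have "(\<Sum>u=1..k. G u v) = y v - y (v - 1)" using eqs v by (simp add: margin_equations_def G_def)
    finally show ?thesis using mesh_width_pos[OF y v] by simp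
  qed
  obtain hq where q: "permuton_density hq (\<lambda>z. f (mesh_index x (fst z)) (mesh_index y (snd z)))"
    and max: "\<And>h. is_arg_max permuton_energy (\<lambda>h. h \<in> height_functions_on k l x y I) h \<longleftrightarrow> h = hq"
    using product_step_unique_maximizer[OF x y, of f I \<alpha> \<beta>] row col by (auto simp: f_def)
  have const: "f (mesh_index x s) (mesh_index y t) = G u v / ((x u - x (u - 1)) * (y v - y (v - 1)))"
    if "u \<in> {1..k}" "v \<in> {1..l}" "s \<in> {x (u - 1)<..<x u}" "t \<in> {y (v - 1)<..<y v}" for u v s t
    using f_eq that mesh_index_cell[OF x, of u s] mesh_index_cell[OF y, of v t] by simp
  have uniq: "G u v = real (I u v) * lam' u * mu' v"
    if "\<forall>u\<in>{1..k}. 0 < lam' u" "\<forall>v\<in>{1..l}. 0 < mu' v" "margin_equations k l x y I lam' mu'"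
      "u \<in> {1..k}" "v \<in> {1..l}" for lam' mu' u v
    unfolding G_def using pos by (intro margin_equations_unique[OF I _ _ that(1,2) eqs that(3-5)]) auto
  show ?thesis
  proof (intro conjI allI impI)
    show "\<exists>!h. is_arg_max permuton_energy (\<lambda>h. h \<in> height_functions_on k l x y I) h"
      unfolding max by simp
    fix h assume "is_arg_max permuton_energy (\<lambda>h. h \<in> height_functions_on k l x y I) h"
    then have h: "h = hq" by (simp add: max)
    show "\<exists>g G. permuton_density h g \<and>
        (\<forall>u\<in>{1..k}. \<forall>v\<in>{1..l}. \<forall>s\<in>{x (u - 1)<..<x u}. \<forall>t\<in>{y (v - 1)<..<y v}.
           g (s, t) = G u v / ((x u - x (u - 1)) * (y v - y (v - 1)))) \<and>
        (\<exists>lam mu. (\<forall>u\<in>{1..k}. 0 < lam u) \<and> (\<forall>v\<in>{1..l}. 0 < mu v) \<and>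
           (\<forall>u\<in>{1..k}. \<forall>v\<in>{1..l}. G u v = real (I u v) * lam u * mu v) \<and>
           margin_equations k l x y I lam mu) \<and>
        (\<forall>lam mu. (\<forall>u\<in>{1..k}. 0 < lam u) \<and> (\<forall>v\<in>{1..l}. 0 < mu v) \<and>
           margin_equations k l x y I lam mu \<longrightarrow>
           (\<forall>u\<in>{1..k}. \<forall>v\<in>{1..l}. G u v = real (I u v) * lam u * mu v))"
    proof (rule exI, rule exI[of _ G], intro conjI)
      show "permuton_density h (\<lambda>z. f (mesh_index x (fst z)) (mesh_index y (snd z)))" using q h by simp
      show "\<exists>lam mu. (\<forall>u\<in>{1..k}. 0 < lam u) \<and> (\<forall>v\<in>{1..l}. 0 < mu v) \<and>
           (\<forall>u\<in>{1..k}. \<forall>v\<in>{1..l}. G u v = real (I u v) * lam u * mu v) \<and>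
           margin_equations k l x y I lam mu"
        using pos eqs by (intro exI[of _ lam] exI[of _ mu]) (simp add: G_def)
      show "\<forall>u\<in>{1..k}. \<forall>v\<in>{1..l}. \<forall>s\<in>{x (u - 1)<..<x u}. \<forall>t\<in>{y (v - 1)<..<y v}.
          f (mesh_index x (fst (s, t))) (mesh_index y (snd (s, t))) = G u v / ((x u - x (u - 1)) * (y v - y (v - 1)))"
        unfolding fst_conv snd_conv by (intro ballI const)
    qed (use uniq in blast)
  qed
qed

end
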